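(* Let $\kappa>0$ and let $X$ be a complete CAT($\kappa$) space with $\operatorname{diam}(X)\le\frac{\pi-\varepsilon}{2\sqrt{\kappa}}$ for some $\varepsilon\in(0,\pi/2)$, and put $R=(\pi-2\varepsilon)\tan(\varepsilon)$. Let $K$ be a nonempty closed convex subset of $X$, and let $T:K\to KC(X)$ be a generalized multivalued hybrid mapping of type II with $\frac{2k_1(x)}{1-a_2(x)}<\frac{R}{2}$ for all $x\in K$, $F(T)\neq\emptyset$ and $Tp=\{p\}$ for all $p\in F(T)$. Let $\{\alpha_n\},\{\beta_n\}$ be sequences in $[0,1]$ and let $\{x_n\}$ be a sequence in $K$ defined by $$x_{n+1}=P_K((1-\alpha_n)y_n\oplus\alpha_n u_n),\qquad y_n=P_K((1-\beta_n)x_n\oplus\beta_n v_n),$$ where $u_n\in Ty_n$ and $v_n\in Tx_n$. Suppose that, for all $x\in K$, $$\liminf_{n\to\infty}\alpha_n\Big[(1-\alpha_n)\frac{R}{2}-\frac{2k_2(x)}{1-a_3(x)}\Big]>0\quad\text{and}\quad \liminf_{n\to\infty}\beta_n\Big[(1-\beta_n)\frac{R}{2}-\frac{2k_2(x)}{1-a_3(x)}\Big]>0.$$ Then $\{x_n\}$ has a $\Delta$-limit, and this limit is in $F(T)$.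
   Context: $(X,d)$ is a metric space. A CAT($\kappa$) space ($\kappa>0$) is a metric space in which any two points at distance less than $D_\kappa=\pi/\sqrt{\kappa}$ are joined by a geodesic, and in which every geodesic triangle of perimeter less than $2D_\kappa$ satisfies $d(p,q)\le d(\bar p,\bar q)$ for all points $p,q$ of the triangle and their comparison points $\bar p,\bar q$ in a comparison triangle in the model surface $M_\kappa^2$ (the sphere $S^2$ with its distance multiplied by $1/\sqrt{\kappa}$). A subset is convex if it contains every geodesic segment joining any two of its points. For $x,y\in X$ and $t\in[0,1]$, $(1-t)x\oplus ty$ is the point $z$ of the geodesic segment $[x,y]$ with $d(z,x)=t\,d(x,y)$ and $d(z,y)=(1-t)d(x,y)$. $P_K:X\to K$ is the metric projection ($P_K(x)$ is the unique point of $K$ nearest to $x$). $KC(X)$ is the family of nonempty compact convex subsets of $X$. $F(T)=\{x\in K: x\in Tx\}$. For a set $B$, $d(x,B)=d(B,x)=\inf\{d(x,y):y\in B\}$, and $H(A,B)=\max\{\sup_{x\in A}d(x,B),\sup_{x\in B}d(x,A)\}$ is the Hausdorff metric. For a bounded sequence $\{x_n\}$ put $r(x,\{x_n\})=\limsup_{n\to\infty}d(x,x_n)$, $r(\{x_n\})=\inf_{x\in X}r(x,\{x_n\})$; the asymptotic center is $A(\{x_n\})=\{x\in X: r(x,\{x_n\})=r(\{x_n\})\}$. The sequence $\{x_n\}$ is $\Delta$-convergent to $x$ ($x$ is the $\Delta$-limit) if $x$ is the unique asymptotic center of every subsequence of $\{x_n\}$. $T$ is a generalized multivalued hybrid mapping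 of type II on $K$ (with coefficient functions $a_1,a_2,a_3,k_1,k_2:K\to[0,1]$) if $a_1(x)+a_2(x)+a_3(x)<1$, $2k_1(x)<1-a_2(x)$ and $2k_2(x)<1-a_3(x)$ for all $x\in K$, and $$H^2(Tx,Ty)\le a_1(x)d^2(x,y)+a_2(x)d^2(Tx,y)+a_3(x)d^2(x,Ty)+k_1(x)d^2(Tx,x)+k_2(x)d^2(Ty,y)$$ for all $x,y\in K$. *)

theory Defs
  imports "HOL-Analysis.Analysis"
begin

section \<open>Geodesics and CAT(\<open>\<kappa>\<close>) spaces\<close>

text \<open>
  Geodesic segments are defined for an explicit carrier and distance function, because they are
  needed both for the ambient metric space and for the model sphere, whose distance is not the
  one inherited from Euclidean space.
\<close>

definition geodesic_segment :: "'a set \<Rightarrow> ('a \<Rightarrow> 'a \<Rightarrow> real) \<Rightarrow> 'a \<Rightarrow> 'a \<Rightarrow> 'a set \<Rightarrow> bool" where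
  "geodesic_segment M d x y S \<longleftrightarrow>
     (\<exists>c. c 0 = x \<and> c (d x y) = y \<and> c ` {0..d x y} \<subseteq> M \<and>
          (\<forall>s\<in>{0..d x y}. \<forall>t\<in>{0..d x y}. d (c s) (c t) = \<bar>s - t\<bar>) \<and>
          S = c ` {0..d x y})"

abbreviation segment :: "'a::metric_space \<Rightarrow> 'a \<Rightarrow> 'a set \<Rightarrow> bool" where
  "segment \<equiv> geodesic_segment UNIV dist"

abbreviation model_space :: "(real ^ 3) set" where
  "model_space \<equiv> sphere 0 1"

definition model_dist :: "real \<Rightarrow> real ^ 3 \<Rightarrow> real ^ 3 \<Rightarrow> real" where
  "model_dist \<kappa> p q = arccos (p \<bullet> q) / sqrt \<kappa>"

text \<open>
  The pairs of a point of the side \<open>S\<close> (joining \<open>x\<close> to \<open>y\<close>) and its comparison point on the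
  side \<open>S'\<close> (starting at \<open>x'\<close>) of a triangle in the model space.
\<close>

definition comparison_pairs ::
    "real \<Rightarrow> 'a::metric_space \<Rightarrow> 'a set \<Rightarrow> real ^ 3 \<Rightarrow> (real ^ 3) set \<Rightarrow> ('a \<times> (real ^ 3)) set" where
  "comparison_pairs \<kappa> x S x' S' = {(p, p'). p \<in> S \<and> p' \<in> S' \<and> model_dist \<kappa> x' p' = dist x p}"

text \<open>
  A comparison triangle of a triangle of perimeter less than twice \<open>pi / sqrt \<kappa>\<close> exists and is
  unique up to isometry, so asking for the inequality in some comparison triangle or in all of
  them is the same.
\<close>

definition CAT_inequality ::
    "real \<Rightarrow> 'a::metric_space \<Rightarrow> 'a \<Rightarrow> 'a \<Rightarrow> 'a set \<Rightarrow> 'a set \<Rightarrow> 'a set \<Rightarrow> bool" where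
  "CAT_inequality \<kappa> x y z Sxy Syz Szx \<longleftrightarrow>
     (\<exists>x'\<in>model_space. \<exists>y'\<in>model_space. \<exists>z'\<in>model_space. \<exists>Sxy' Syz' Szx'.
        model_dist \<kappa> x' y' = dist x y \<and>
        model_dist \<kappa> y' z' = dist y z \<and>
        model_dist \<kappa> z' x' = dist z x \<and>
        geodesic_segment model_space (model_dist \<kappa>) x' y' Sxy' \<and>
        geodesic_segment model_space (model_dist \<kappa>) y' z' Syz' \<and>
        geodesic_segment model_space (model_dist \<kappa>) z' x' Szx' \<and>
        (let C = comparison_pairs \<kappa> x Sxy x' Sxy' \<union>
                 comparison_pairs \<kappa> y Syz y' Syz' \<union>
                 comparison_pairs \<kappa> z Szx z' Szx'
         in \<forall>(p, p')\<in>C. \<forall>(q, q')\<in>C. dist p q \<le> model_dist \<kappa> p' q'))"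

definition CAT_space :: "real \<Rightarrow> 'a::metric_space itself \<Rightarrow> bool" where
  "CAT_space \<kappa> (_ :: 'a itself) \<longleftrightarrow>
     (\<forall>x y :: 'a. dist x y < pi / sqrt \<kappa> \<longrightarrow> (\<exists>S. segment x y S)) \<and>
     (\<forall>(x :: 'a) y z Sxy Syz Szx.
        segment x y Sxy \<longrightarrow> segment y z Syz \<longrightarrow> segment z x Szx \<longrightarrow>
        dist x y + dist y z + dist z x < 2 * (pi / sqrt \<kappa>) \<longrightarrow>
        CAT_inequality \<kappa> x y z Sxy Syz Szx)"

definition geodesically_convex :: "'a::metric_space set \<Rightarrow> bool" where
  "geodesically_convex K \<longleftrightarrow> (\<forall>x\<in>K. \<forall>y\<in>K. \<forall>S. segment x y S \<longrightarrow> S \<subseteq> K)"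

text \<open>The point \<open>(1 - t) x \<oplus> t y\<close>; well defined when the geodesic from \<open>x\<close> to \<open>y\<close> is unique.\<close>

definition geodesic_comb :: "real \<Rightarrow> 'a::metric_space \<Rightarrow> 'a \<Rightarrow> 'a" where
  "geodesic_comb t x y =
     (THE z. \<exists>S. segment x y S \<and> z \<in> S \<and>
                 dist z x = t * dist x y \<and> dist z y = (1 - t) * dist x y)"

definition metric_proj :: "'a::metric_space set \<Rightarrow> 'a \<Rightarrow> 'a" where
  "metric_proj K x = (THE p. p \<in> K \<and> (\<forall>q\<in>K. dist x p \<le> dist x q))"

definition KC :: "'a::metric_space set set" where
  "KC = {A. A \<noteq> {} \<and> compact A \<and> geodesically_convex A}"


section \<open>Multivalued mappings\<close>

text \<open>The suprema are meaningful for nonempty bounded sets, in particular for members of \<open>KC\<close>.\<close>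

definition hausdorff_dist :: "'a::metric_space set \<Rightarrow> 'a set \<Rightarrow> real" where
  "hausdorff_dist A B = max (SUP x\<in>A. infdist x B) (SUP x\<in>B. infdist x A)"

definition fixed_points :: "'a set \<Rightarrow> ('a \<Rightarrow> 'a set) \<Rightarrow> 'a set" where
  "fixed_points K T = {x \<in> K. x \<in> T x}"

definition generalized_hybrid_II ::
    "'a::metric_space set \<Rightarrow> ('a \<Rightarrow> 'a set) \<Rightarrow>
     ('a \<Rightarrow> real) \<Rightarrow> ('a \<Rightarrow> real) \<Rightarrow> ('a \<Rightarrow> real) \<Rightarrow> ('a \<Rightarrow> real) \<Rightarrow> ('a \<Rightarrow> real) \<Rightarrow> bool" where
  "generalized_hybrid_II K T a\<^sub>1 a\<^sub>2 a\<^sub>3 k\<^sub>1 k\<^sub>2 \<longleftrightarrow>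
     a\<^sub>1 \<in> K \<rightarrow> {0..1} \<and> a\<^sub>2 \<in> K \<rightarrow> {0..1} \<and> a\<^sub>3 \<in> K \<rightarrow> {0..1} \<and>
     k\<^sub>1 \<in> K \<rightarrow> {0..1} \<and> k\<^sub>2 \<in> K \<rightarrow> {0..1} \<and>
     (\<forall>x\<in>K. a\<^sub>1 x + a\<^sub>2 x + a\<^sub>3 x < 1 \<and> 2 * k\<^sub>1 x < 1 - a\<^sub>2 x \<and> 2 * k\<^sub>2 x < 1 - a\<^sub>3 x) \<and>
     (\<forall>x\<in>K. \<forall>y\<in>K.
        (hausdorff_dist (T x) (T y))\<^sup>2 \<le>
          a\<^sub>1 x * (dist x y)\<^sup>2 + a\<^sub>2 x * (infdist y (T x))\<^sup>2 + a\<^sub>3 x * (infdist x (T y))\<^sup>2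
          + k\<^sub>1 x * (infdist x (T x))\<^sup>2 + k\<^sub>2 x * (infdist y (T y))\<^sup>2)"


section \<open>\<open>\<Delta>\<close>-convergence\<close>

definition asymptotic_radius_at :: "'a::metric_space \<Rightarrow> (nat \<Rightarrow> 'a) \<Rightarrow> ereal" where
  "asymptotic_radius_at x s = limsup (\<lambda>n. ereal (dist x (s n)))"

definition asymptotic_radius :: "(nat \<Rightarrow> 'a::metric_space) \<Rightarrow> ereal" where
  "asymptotic_radius s = (INF x. asymptotic_radius_at x s)"

definition asymptotic_center :: "(nat \<Rightarrow> 'a::metric_space) \<Rightarrow> 'a set" where
  "asymptotic_center s = {x. asymptotic_radius_at x s = asymptotic_radius s}"

definition Delta_convergent_to :: "(nat \<Rightarrow> 'a::metric_space) \<Rightarrow> 'a \<Rightarrow> bool" where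
  "Delta_convergent_to s x \<longleftrightarrow>
     bounded (range s) \<and> (\<forall>\<phi>. strict_mono \<phi> \<longrightarrow> asymptotic_center (s \<circ> \<phi>) = {x})"

end

theory Submission
  imports Defs "HOL-Library.Diagonal_Subsequence"
begin

text \<open>
  Everything rests on one consequence of comparison with the sphere: in a CAT(\<open>\<kappa>\<close>) space whose
  scaled diameter is \<open>L < \<pi>/2\<close>, squared distances are strongly convex along geodesics,
  \<open>d\<^sup>2(m, z) \<le> (1 - t) d\<^sup>2(x, z) + t d\<^sup>2(y, z) - k t (1 - t) d\<^sup>2(x, y)\<close>, for every \<open>k\<close> with
  \<open>k \<le> L cot L\<close> (\<open>small_CAT_square_convex\<close>). Here \<open>L = (\<pi> - \<epsilon>)/2\<close>, so the best constant is
  \<open>(\<pi> - \<epsilon>) tan(\<epsilon>/2) / 2\<close>. This is smaller than \<open>R/2\<close>, but it is at least \<open>R/4\<close>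
  (\<open>modulus_quarter_le\<close>), and \<open>k = R/4\<close> suffices: the hypotheses bound \<open>2 k\<^sub>1 / (1 - a\<^sub>2)\<close> and
  \<open>2 k\<^sub>2 / (1 - a\<^sub>3)\<close> in terms of \<open>R/2\<close>, that is, \<open>k\<^sub>1 / (1 - a\<^sub>2)\<close> and \<open>k\<^sub>2 / (1 - a\<^sub>3)\<close> in terms of \<open>R/4\<close>.

  Let \<open>p\<close> be a fixed point. As \<open>Tp = {p}\<close>, the hybrid inequality gives
  \<open>d\<^sup>2(v, p) \<le> d\<^sup>2(x, p) + c d\<^sup>2(x, v)\<close> for \<open>v \<in> Tx\<close>, with \<open>c = k\<^sub>2(p) / (1 - a\<^sub>3(p))\<close>. Strong convexity, and the
  fact that projecting onto \<open>K\<close> does not increase the distance to points of \<open>K\<close>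
  (\<open>metric_proj_contracts\<close>), turn this into
  \<open>d\<^sup>2(y\<^sub>n, p) \<le> d\<^sup>2(x\<^sub>n, p) - \<beta>\<^sub>n ((1 - \<beta>\<^sub>n) k - c) d\<^sup>2(x\<^sub>n, v\<^sub>n)\<close>, and into the analogous estimate from
  \<open>y\<^sub>n\<close> to \<open>x\<^sub>n\<^sub>+\<^sub>1\<close>. The conditions on the lower limits then make \<open>d(x\<^sub>n, p)\<close> eventually decreasing and
  force \<open>d(x\<^sub>n, Tx\<^sub>n) \<rightarrow> 0\<close>.

  Strong convexity also makes asymptotic centers exist and be unique, and it gives a demiclosedness
  principle (\<open>asymptotic_center_in_compact\<close>): the center \<open>z\<close> of a regular subsequence, one whose
  asymptotic radius does not drop on passing to further subsequences, lies in \<open>Tz\<close>. Since every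
  sequence has regular subsequences, every subsequence of \<open>x\<^sub>n\<close> has a fixed point as its center, and
  convergence of the distances to fixed points shows that these centers coincide
  (\<open>Delta_convergent_if_Fejer\<close>).
\<close>

section \<open>Spherical comparison of squared distances\<close>

lemma mult_cos_le_sin:
  fixes q :: real
  assumes "0 \<le> q" "q \<le> pi"
  shows "q * cos q \<le> sin q"
proof -
  have "sin 0 - 0 * cos 0 \<le> sin q - q * cos q"
  proof (rule DERIV_nonneg_imp_nondecreasing[where f = "\<lambda>x. sin x - x * cos x"])
    fix x assume x: "0 \<le> x" "x \<le> q"
    have "((\<lambda>x. sin x - x * cos x) has_real_derivative x * sin x) (at x)"
      by (auto intro!: derivative_eq_intros)
    moreover have "0 \<le> x * sin x"
      using x assms by (simp add: sin_ge_zero)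
    ultimately show "\<exists>y. ((\<lambda>x. sin x - x * cos x) has_real_derivative y) (at x) \<and> 0 \<le> y"
      by blast
  qed (use assms in auto)
  then show ?thesis by simp
qed

text \<open>
  The function \<open>q cos q - c sin q\<close> is concave on \<open>[0, \<pi>/2]\<close> and vanishes at \<open>0\<close>, so its sign at \<open>L\<close>
  decides its sign on \<open>[0, L]\<close>.
\<close>

lemma mult_sin_le_mult_cos:
  fixes c L q :: real
  assumes L: "0 < L" "L \<le> pi / 2" and c: "c \<le> 1" and end_le: "c * sin L \<le> L * cos L"
    and q: "0 \<le> q" "q \<le> L"
  shows "c * sin q \<le> q * cos q"
proof -
  let ?k = "\<lambda>q. q * cos q - c * sin q"
  have "concave_on {0..pi/2} ?k"
  proof (rule f''_le0_imp_concave)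
    fix x :: real assume x: "x \<in> {0..pi/2}"
    show "(?k has_real_derivative (1 - c) * cos x - x * sin x) (at x)"
      by (auto intro!: derivative_eq_intros simp: algebra_simps)
    show "((\<lambda>x. (1 - c) * cos x - x * sin x) has_real_derivative
            - ((1 - c) * sin x + sin x + x * cos x)) (at x)"
      by (auto intro!: derivative_eq_intros simp: algebra_simps)
    have "0 \<le> sin x" "0 \<le> cos x"
      using x by (auto intro!: sin_ge_zero cos_ge_zero)
    then have "0 \<le> (1 - c) * sin x" "0 \<le> x * cos x"
      using x c by auto
    then show "- ((1 - c) * sin x + sin x + x * cos x) \<le> 0"
      using \<open>0 \<le> sin x\<close> by linarith
  qed simp
  from concave_onD[OF this, of "q / L" 0 L]
  have "(q / L) * ?k L \<le> ?k q"
    using L q by simp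
  moreover have "0 \<le> (q / L) * ?k L"
    using L q end_le by simp
  ultimately show ?thesis by simp
qed

lemma cos_ge_chord:
  fixes e :: real
  assumes "0 \<le> e" "e \<le> pi / 2"
  shows "1 - 2 * e / pi \<le> cos e"
proof -
  have "concave_on {0..pi/2} (cos :: real \<Rightarrow> real)"
  proof (rule f''_le0_imp_concave)
    fix x :: real assume x: "x \<in> {0..pi/2}"
    show "(cos has_real_derivative - sin x) (at x)"
      by (auto intro!: derivative_eq_intros)
    show "((\<lambda>x. - sin x) has_real_derivative - cos x) (at x)"
      by (auto intro!: derivative_eq_intros)
    show "- cos x \<le> 0"
      using x by (auto intro!: cos_ge_zero)
  qed simp
  from concave_onD[OF this, of "2 * e / pi" 0 "pi/2"] show ?thesis
    using assms by simp
qed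

text \<open>
  In terms of \<open>\<eta> = \<pi>/2 - \<epsilon>\<close> the left-hand side is \<open>(\<eta> cot \<eta>) / 2\<close>, and \<open>\<eta> cot \<eta> \<le> 1\<close>.
\<close>

lemma modulus_quarter_le_half:
  fixes e :: real
  assumes "0 < e" "e < pi / 2"
  shows "(pi - 2 * e) * tan e / 4 \<le> 1 / 2"
proof -
  have "(pi / 2 - e) * cos (pi / 2 - e) \<le> sin (pi / 2 - e)"
    using assms by (intro mult_cos_le_sin) auto
  then have "(pi / 2 - e) * sin e \<le> cos e"
    by (simp add: sin_diff cos_diff)
  moreover have "0 < cos e" using assms by (intro cos_gt_zero) auto
  ultimately show ?thesis by (simp add: tan_def field_simps)
qed

text \<open>
  The left-hand constant \<open>R/4\<close> is half the value of \<open>\<eta> cot \<eta>\<close> at \<open>\<eta> = \<pi>/2 - \<epsilon>\<close>; it is compared with the constant \<open>L cot L\<close>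
  that the larger radius \<open>L = \<pi>/2 - \<epsilon>/2\<close> provides. With \<open>s = \<epsilon>/2\<close> the claim reduces to
  \<open>\<pi> sin\<^sup>2 s \<le> 2 s\<close>, which says that the graph of the cosine on \<open>[0, \<pi>/2]\<close> lies above its chord.
\<close>

lemma modulus_quarter_le:
  fixes e :: real
  assumes e: "0 < e" "e < pi / 2"
  defines "L \<equiv> (pi - e) / 2"
  shows "(pi - 2 * e) * tan e / 4 * sin L \<le> L * cos L"
proof -
  define s where "s = e / 2"
  have s: "0 < s" "s < pi / 4" and e_s: "e = 2 * s"
    using e by (auto simp: s_def)
  have L_eq: "L = pi / 2 - s" by (simp add: L_def s_def field_simps)
  have LL: "sin L = cos s" "cos L = sin s"
    unfolding L_eq by (simp_all add: sin_diff cos_diff)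
  have s0: "0 < sin s" using s by (intro sin_gt_zero) auto
  have c0: "0 < cos e" using e by (intro cos_gt_zero) auto
  have ce: "cos e = 1 - 2 * (sin s)\<^sup>2" unfolding e_s by (rule cos_double_sin)
  have se: "sin e = 2 * sin s * cos s" unfolding e_s by (rule sin_double)
  have cs: "(cos s)\<^sup>2 = 1 - (sin s)\<^sup>2" by (simp add: cos_squared_eq)
  have "pi * (sin s)\<^sup>2 \<le> 2 * s"
    using cos_ge_chord[of e] e unfolding ce by (simp add: field_simps e_s)
  then have key: "(pi - 4 * s) * (cos s)\<^sup>2 \<le> (pi - 2 * s) * cos e"
    unfolding cs ce by (simp add: algebra_simps)
  have "(pi - 2 * e) * sin e * cos s = 2 * sin s * ((pi - 4 * s) * (cos s)\<^sup>2)"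
    unfolding se by (simp add: e_s power2_eq_square)
  also have "\<dots> \<le> 2 * sin s * ((pi - 2 * s) * cos e)"
    using key s0 by (intro mult_left_mono) auto
  finally have "(pi - 2 * e) * sin e * cos s \<le> 4 * (L * sin s) * cos e"
    by (simp add: L_eq algebra_simps)
  then show ?thesis
    using c0 unfolding LL tan_def by (simp add: field_simps)
qed

text \<open>
  Sturm comparison: on an interval shorter than \<open>\<pi>\<close> a subsolution of \<open>w'' + w = 0\<close> lies below the
  solution with the same boundary values. Dividing \<open>w\<close> by \<open>C s = cos(s - a/2)\<close>, a positive solution, reduces
  this to a maximum principle: \<open>C\<^sup>2 (w/C)'\<close> is nondecreasing, so \<open>w/C\<close> cannot have a positive interior maximum
  and then come down to a nonpositive value at \<open>a\<close>.
\<close>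

lemma sturm_nonpos:
  fixes w w' w'' :: "real \<Rightarrow> real"
  assumes a: "0 < a" "a < pi"
    and cont: "continuous_on {0..a} w"
    and w': "\<And>s. 0 < s \<Longrightarrow> s < a \<Longrightarrow> (w has_real_derivative w' s) (at s)"
    and w'': "\<And>s. 0 < s \<Longrightarrow> s < a \<Longrightarrow> (w' has_real_derivative w'' s) (at s)"
    and ode: "\<And>s. 0 < s \<Longrightarrow> s < a \<Longrightarrow> 0 \<le> w'' s + w s"
    and ends: "w 0 \<le> 0" "w a \<le> 0"
    and s: "s \<in> {0..a}"
  shows "w s \<le> 0"
proof -
  define C where "C = (\<lambda>s. cos (s - a / 2))"
  have C_pos: "0 < C x" if "x \<in> {0..a}" for x
    using that a unfolding C_def by (intro cos_gt_zero_pi) auto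
  define g where "g = (\<lambda>s. w s / C s)"
  have cont_g: "continuous_on {0..a} g"
    unfolding g_def using C_pos
    by (intro continuous_intros cont) (auto simp: C_def intro!: continuous_intros less_imp_neq[symmetric])
  obtain m where m: "m \<in> {0..a}" and max: "\<And>x. x \<in> {0..a} \<Longrightarrow> g x \<le> g m"
    using continuous_attains_sup[of "{0..a}" g] cont_g a by auto
  define P where "P = (\<lambda>s. w' s * C s + w s * sin (s - a / 2))"
  have g': "(g has_real_derivative P x / (C x)\<^sup>2) (at x)" if "0 < x" "x < a" for x
    unfolding g_def C_def
    by (rule derivative_eq_intros w' that refl)+
      (use C_pos[of x] that in \<open>auto simp: C_def P_def power2_eq_square field_simps\<close>)
  have P': "(P has_real_derivative (w'' x + w x) * C x) (at x)" if "0 < x" "x < a" for x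
    unfolding P_def C_def
    by (rule derivative_eq_intros w' w'' that refl)+ (simp add: algebra_simps)
  have "g m \<le> 0"
  proof (rule ccontr)
    assume "\<not> g m \<le> 0"
    then have gm: "0 < g m" by simp
    have "g 0 \<le> 0" "g a \<le> 0"
      using ends C_pos[of 0] C_pos[of a] a by (auto simp: g_def divide_nonpos_pos)
    then have m0: "0 < m" "m < a"
      using gm m by (auto simp: less_le)
    have "P m / (C m)\<^sup>2 = 0"
    proof (rule DERIV_local_max[OF g'[OF m0]])
      show "0 < min m (a - m)" using m0 by simp
      show "\<forall>y. \<bar>m - y\<bar> < min m (a - m) \<longrightarrow> g y \<le> g m"
        by (auto intro!: max)
    qed
    then have Pm: "P m = 0" using C_pos[OF m] by simp
    have P_nonneg: "0 \<le> P x" if x: "m \<le> x" "x < a" for x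
    proof -
      have "P m \<le> P x"
      proof (rule DERIV_nonneg_imp_nondecreasing[OF x(1)])
        fix y assume y: "m \<le> y" "y \<le> x"
        then show "\<exists>d. (P has_real_derivative d) (at y) \<and> 0 \<le> d"
          using P'[of y] ode[of y] C_pos[of y] m0 x by (intro exI[of _ "(w'' y + w y) * C y"]) auto
      qed
      then show ?thesis using Pm by simp
    qed
    have "g m \<le> g a"
    proof (rule DERIV_nonneg_imp_increasing_open[where f = g])
      show "m \<le> a" using m0 by simp
      show "continuous_on {m..a} g" using m0 by (intro continuous_on_subset[OF cont_g]) auto
      fix y assume "m < y" "y < a"
      then show "\<exists>d. (g has_real_derivative d) (at y) \<and> 0 \<le> d"
        using g'[of y] P_nonneg[of y] m0 by (intro exI[of _ "P y / (C y)\<^sup>2"]) auto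
    qed
    with gm \<open>g a \<le> 0\<close> show False by simp
  qed
  with max[OF s] have "g s \<le> 0" by simp
  then show ?thesis
    using C_pos[OF s] by (simp add: g_def divide_le_0_iff)
qed

text \<open>
  The right-hand side, divided by \<open>sin a\<close>, is the cosine of the distance on the unit sphere from a point to
  the point at parameter \<open>t\<close> on an arc of length \<open>a\<close>, when the distances to the ends of the arc are
  \<open>b\<close> and \<open>c\<close>. So the inequality says that this distance is at most \<open>sqrt (h t)\<close>. The squared distance itself is
  awkward to differentiate, and is avoided: as a function of arc length the right-hand side solves
  \<open>w'' + w = 0\<close>, and \<open>cos (sqrt h)\<close> is a subsolution with the same boundary values because
  \<open>k \<le> q cot q \<le> 1\<close> for \<open>q = sqrt h\<close>. The condition \<open>k < 1\<close> keeps \<open>h\<close> positive in the interior, where \<open>sqrt h\<close> is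
  therefore smooth.
\<close>

lemma cos_sqrt_le_spherical_interpolation:
  fixes a b c :: real
  assumes k: "0 \<le> k" "k < 1" and L: "0 < L" "L < pi / 2"
    and modulus: "\<And>q. 0 \<le> q \<Longrightarrow> q \<le> L \<Longrightarrow> k * sin q \<le> q * cos q"
    and b: "0 \<le> b" "b \<le> L" and c: "0 \<le> c" "c \<le> L"
    and a: "0 < a" "a < pi" "a \<le> b + c"
    and t: "0 \<le> t" "t \<le> 1"
  defines "h \<equiv> (\<lambda>t. (1 - t) * b\<^sup>2 + t * c\<^sup>2 - k * (t * (1 - t) * a\<^sup>2))"
  shows "0 \<le> h t" "h t \<le> L\<^sup>2"
    and "sin a * cos (sqrt (h t)) \<le> sin ((1 - t) * a) * cos b + sin (t * a) * cos c"
proof -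
  have h_ge: "h t \<ge> ((1 - t) * b - t * c)\<^sup>2 + (1 - k) * (t * (1 - t) * a\<^sup>2)"
    if "0 \<le> t" "t \<le> 1" for t
  proof -
    have "a\<^sup>2 \<le> (b + c)\<^sup>2" using a by (intro power_mono) auto
    then have "t * (1 - t) * a\<^sup>2 \<le> t * (1 - t) * (b + c)\<^sup>2"
      using that by (intro mult_left_mono) auto
    moreover have "(1 - t) * b\<^sup>2 + t * c\<^sup>2 - t * (1 - t) * (b + c)\<^sup>2 = ((1 - t) * b - t * c)\<^sup>2"
      by (simp add: power2_eq_square algebra_simps)
    ultimately show ?thesis unfolding h_def by (simp add: algebra_simps)
  qed
  have h_nonneg: "0 \<le> h t" if "0 \<le> t" "t \<le> 1" for t
    using h_ge[OF that] that k by (smt (verit) mult_nonneg_nonneg zero_le_power2)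
  have h_pos: "0 < h t" if "0 < t" "t < 1" for t
  proof -
    have "0 < (1 - k) * (t * (1 - t) * a\<^sup>2)" using that k a by simp
    then show ?thesis using h_ge[of t] that by (smt (verit) zero_le_power2)
  qed
  have h_le: "h t \<le> L\<^sup>2" if "0 \<le> t" "t \<le> 1" for t
  proof -
    have "b\<^sup>2 \<le> L\<^sup>2" "c\<^sup>2 \<le> L\<^sup>2" using b c by (auto intro: power_mono)
    then have "(1 - t) * b\<^sup>2 + t * c\<^sup>2 \<le> (1 - t) * L\<^sup>2 + t * L\<^sup>2"
      using that by (intro add_mono mult_left_mono) auto
    moreover have "0 \<le> k * (t * (1 - t) * a\<^sup>2)" using k that by simp
    ultimately show ?thesis unfolding h_def by (simp add: algebra_simps)
  qed
  show "0 \<le> h t" "h t \<le> L\<^sup>2" using h_nonneg h_le t by auto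

  define H where "H = (\<lambda>s. h (s / a))"
  define H' where "H' = (\<lambda>s. (c\<^sup>2 - b\<^sup>2) / a - k * (a - 2 * s))"
  define q where "q = (\<lambda>s. sqrt (H s))"
  define w where "w = (\<lambda>s. sin a * cos (q s) - sin (a - s) * cos b - sin s * cos c)"
  define w' where "w' = (\<lambda>s. - sin a * (H' s * sin (q s) / (2 * q s)) + cos (a - s) * cos b - cos s * cos c)"
  define w'' where "w'' = (\<lambda>s. sin a * ((H' s)\<^sup>2 * (sin (q s) - q s * cos (q s)) / (4 * q s ^ 3)
       - k * sin (q s) / q s) + sin (a - s) * cos b + sin s * cos c)"
  have H_expand: "H s = b\<^sup>2 + s * ((c\<^sup>2 - b\<^sup>2) / a) - k * (s * (a - s))" for s
    using a by (simp add: H_def h_def field_simps power2_eq_square)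
  have q_pos: "0 < q s" if "0 < s" "s < a" for s
    using h_pos[of "s / a"] that a by (simp add: q_def H_def)
  have q_le: "q s \<le> L" if "0 < s" "s < a" for s
    using h_le[of "s / a"] that a L by (simp add: q_def H_def real_le_lsqrt)
  have q': "(q has_real_derivative H' s / (2 * q s)) (at s)" if "0 < s" "s < a" for s
  proof -
    have "(H has_real_derivative H' s) (at s)"
      unfolding H_expand H'_def using a
      by (auto intro!: derivative_eq_intros simp: field_simps)
    moreover have "0 < H s" using q_pos[OF that] by (simp add: q_def)
    ultimately show ?thesis
      unfolding q_def by (auto intro!: derivative_eq_intros simp: field_simps)
  qed
  have H'': "(H' has_real_derivative 2 * k) (at s)" for s
    unfolding H'_def by (auto intro!: derivative_eq_intros)
  have sin_a: "0 < sin a" using a by (intro sin_gt_zero) auto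
  have "w (t * a) \<le> 0"
  proof (rule sturm_nonpos[of a w w' w''])
    show "continuous_on {0..a} w"
      unfolding w_def q_def H_expand using a by (intro continuous_intros) auto
    show "w 0 \<le> 0" using b by (simp add: w_def q_def H_expand)
    show "w a \<le> 0" using a c by (simp add: w_def q_def H_expand)
    show "t * a \<in> {0..a}" using t a by (simp add: mult_left_le_one_le)
    fix s assume s: "0 < s" "s < a"
    note qp = q_pos[OF s]
    then have q_ne: "2 * q s \<noteq> 0" by simp
    show "(w has_real_derivative w' s) (at s)"
      unfolding w_def w'_def
      by (rule derivative_eq_intros q' s refl)+ (use qp in \<open>simp add: field_simps\<close>)
    show "(w' has_real_derivative w'' s) (at s)"
      unfolding w'_def w''_def
      by (rule derivative_eq_intros q' H'' s q_ne refl)+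
        (use qp in \<open>simp_all add: field_simps power2_eq_square power3_eq_cube\<close>)
    have "0 \<le> (H' s)\<^sup>2 * (sin (q s) - q s * cos (q s)) / (4 * q s ^ 3)"
      using qp q_le[OF s] L mult_cos_le_sin[of "q s"] by simp
    moreover have "k * sin (q s) / q s \<le> cos (q s)"
      using modulus[of "q s"] qp q_le[OF s] by (simp add: field_simps)
    ultimately have "0 \<le> sin a * ((H' s)\<^sup>2 * (sin (q s) - q s * cos (q s)) / (4 * q s ^ 3)
        - k * sin (q s) / q s + cos (q s))"
      using sin_a by (intro mult_nonneg_nonneg) auto
    then show "0 \<le> w'' s + w s"
      unfolding w''_def w_def by (simp add: algebra_simps)
  qed (use a in auto)
  moreover have "q (t * a) = sqrt (h t)" using a by (simp add: q_def H_def)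
  ultimately show "sin a * cos (sqrt (h t)) \<le> sin ((1 - t) * a) * cos b + sin (t * a) * cos c"
    by (simp add: w_def left_diff_distrib)
qed

section \<open>Cosine and square inequalities in CAT(\<open>\<kappa>\<close>) spaces\<close>

lemma segment_ends:
  assumes "segment x y S"
  shows "x \<in> S" "y \<in> S"
proof -
  obtain c where c: "c 0 = x" "c (dist x y) = y" "S = c ` {0..dist x y}"
    using assms unfolding geodesic_segment_def by blast
  have "0 \<in> {0..dist x y}" "dist x y \<in> {0..dist x y}" by simp_all
  then show "x \<in> S" "y \<in> S" using c by (metis imageI)+
qed

lemma segment_dist_sum:
  assumes "segment x y S" "m \<in> S"
  shows "dist x m + dist m y = dist x y"
proof -
  obtain c where c: "c 0 = x" "c (dist x y) = y" "S = c ` {0..dist x y}"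
    "\<And>s t. s \<in> {0..dist x y} \<Longrightarrow> t \<in> {0..dist x y} \<Longrightarrow> dist (c s) (c t) = \<bar>s - t\<bar>"
    using assms(1) unfolding geodesic_segment_def by blast
  then obtain s where s: "s \<in> {0..dist x y}" "m = c s"
    using assms(2) by auto
  then have "dist x m = s" "dist m y = dist x y - s"
    using c(4)[of 0 s] c(4)[of s "dist x y"] c(1,2) by auto
  then show ?thesis by simp
qed

lemma segment_point:
  assumes "segment x y S" "0 \<le> t" "t \<le> 1"
  obtains m where "m \<in> S" "dist x m = t * dist x y" "dist m y = (1 - t) * dist x y"
proof -
  obtain c where c: "c 0 = x" "c (dist x y) = y" "S = c ` {0..dist x y}"
    "\<And>s t. s \<in> {0..dist x y} \<Longrightarrow> t \<in> {0..dist x y} \<Longrightarrow> dist (c s) (c t) = \<bar>s - t\<bar>"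
    using assms(1) unfolding geodesic_segment_def by blast
  have t: "t * dist x y \<in> {0..dist x y}"
    using assms(2,3) by (auto simp: mult_left_le_one_le)
  show ?thesis
  proof
    show "c (t * dist x y) \<in> S" using t c(3) by blast
    show "dist x (c (t * dist x y)) = t * dist x y" using c(4)[of 0 "t * dist x y"] c(1) t by auto
    show "dist (c (t * dist x y)) y = (1 - t) * dist x y"
      using c(4)[of "t * dist x y" "dist x y"] c(2) t by (auto simp: left_diff_distrib)
  qed
qed

lemma cos_model_dist:
  assumes "\<kappa> > 0" "p \<in> model_space" "q \<in> model_space"
  shows "cos (sqrt \<kappa> * model_dist \<kappa> p q) = p \<bullet> q"
    and "0 \<le> sqrt \<kappa> * model_dist \<kappa> p q" "sqrt \<kappa> * model_dist \<kappa> p q \<le> pi"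
proof -
  have "\<bar>p \<bullet> q\<bar> \<le> norm p * norm q" by (rule Cauchy_Schwarz_ineq2)
  then have 1: "\<bar>p \<bullet> q\<bar> \<le> 1" using assms by simp
  have "sqrt \<kappa> * model_dist \<kappa> p q = arccos (p \<bullet> q)"
    using assms(1) by (simp add: model_dist_def)
  then show "cos (sqrt \<kappa> * model_dist \<kappa> p q) = p \<bullet> q"
    and "0 \<le> sqrt \<kappa> * model_dist \<kappa> p q" "sqrt \<kappa> * model_dist \<kappa> p q \<le> pi"
    using 1 by (auto simp: cos_arccos_abs intro!: arccos_lbound arccos_ubound)
qed

text \<open>
  A unit vector whose angles \<open>s\<close> and \<open>r\<close> to \<open>x\<close> and \<open>y\<close> add up to the angle between \<open>x\<close> and \<open>y\<close> lies on the
  great circle through them: by the addition theorems the difference of the two sides has norm \<open>0\<close>.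
\<close>

lemma great_circle_point:
  fixes x y m :: "'a::real_inner"
  assumes unit: "x \<bullet> x = 1" "y \<bullet> y = 1" "m \<bullet> m = 1"
    and angles: "x \<bullet> m = cos s" "m \<bullet> y = cos r" "x \<bullet> y = cos (s + r)"
  shows "sin (s + r) *\<^sub>R m = sin r *\<^sub>R x + sin s *\<^sub>R y"
proof -
  have ring_id: "p\<^sup>2 + q\<^sup>2 + 2 * p * q * (u * v - q * p) - (q * v + u * p)\<^sup>2
      = p\<^sup>2 * (1 - u\<^sup>2 - q\<^sup>2) + q\<^sup>2 * (1 - v\<^sup>2 - p\<^sup>2)" for p q u v :: real
    by (simp add: power2_eq_square algebra_simps)
  have angles': "m \<bullet> x = cos s" "y \<bullet> m = cos r" "y \<bullet> x = cos (s + r)"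
    using angles by (simp_all add: inner_commute)
  let ?n = "sin (s + r) *\<^sub>R m - (sin r *\<^sub>R x + sin s *\<^sub>R y)"
  have "?n \<bullet> ?n = (sin (s + r))\<^sup>2 + (sin r)\<^sup>2 + (sin s)\<^sup>2 + 2 * sin r * sin s * cos (s + r)
      - 2 * sin (s + r) * (sin r * cos s + sin s * cos r)"
    by (simp add: unit angles angles' inner_diff_left inner_diff_right inner_add_left inner_add_right
        power2_eq_square algebra_simps)
  also have "\<dots> = (sin r)\<^sup>2 + (sin s)\<^sup>2 + 2 * sin r * sin s * (cos s * cos r - sin s * sin r)
      - (sin s * cos r + cos s * sin r)\<^sup>2"
    by (simp add: sin_add cos_add power2_eq_square algebra_simps)
  also have "\<dots> = (sin r)\<^sup>2 * (1 - (cos s)\<^sup>2 - (sin s)\<^sup>2) + (sin s)\<^sup>2 * (1 - (cos r)\<^sup>2 - (sin r)\<^sup>2)"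
    by (rule ring_id)
  also have "\<dots> = 0" by (simp add: cos_squared_eq)
  finally show ?thesis by simp
qed

text \<open>
  In the comparison triangle this is an equality, since the comparison point of \<open>m\<close> is a linear
  combination of the end points of its side. Passing back to the space only shortens the distance from
  \<open>m\<close> to \<open>z\<close>.
\<close>

lemma CAT_cosine_inequality:
  fixes x y z m :: "'a::metric_space"
  assumes \<kappa>: "\<kappa> > 0" and CAT: "CAT_space \<kappa> TYPE('a)"
    and S: "segment x y S" "m \<in> S"
    and short: "dist y z < pi / sqrt \<kappa>" "dist z x < pi / sqrt \<kappa>"
    and perimeter: "dist x y + dist y z + dist z x < 2 * (pi / sqrt \<kappa>)"
  shows "sin (sqrt \<kappa> * dist m y) * cos (sqrt \<kappa> * dist x z)
       + sin (sqrt \<kappa> * dist x m) * cos (sqrt \<kappa> * dist y z)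
       \<le> sin (sqrt \<kappa> * dist x y) * cos (sqrt \<kappa> * dist m z)"
proof -
  obtain Syz Szx where sides: "segment y z Syz" "segment z x Szx"
    using CAT short unfolding CAT_space_def by meson
  have "CAT_inequality \<kappa> x y z S Syz Szx"
    using CAT S(1) sides perimeter unfolding CAT_space_def by blast
  then obtain x' y' z' Sxy' Syz' Szx' where
    pts: "x' \<in> model_space" "y' \<in> model_space" "z' \<in> model_space"
    and d: "model_dist \<kappa> x' y' = dist x y" "model_dist \<kappa> y' z' = dist y z" "model_dist \<kappa> z' x' = dist z x"
    and geo: "geodesic_segment model_space (model_dist \<kappa>) x' y' Sxy'"
      "geodesic_segment model_space (model_dist \<kappa>) y' z' Syz'"
      "geodesic_segment model_space (model_dist \<kappa>) z' x' Szx'"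
    and le: "let C = comparison_pairs \<kappa> x S x' Sxy' \<union> comparison_pairs \<kappa> y Syz y' Syz' \<union>
                 comparison_pairs \<kappa> z Szx z' Szx'
         in \<forall>(p, p')\<in>C. \<forall>(q, q')\<in>C. dist p q \<le> model_dist \<kappa> p' q'"
    unfolding CAT_inequality_def by blast
  have sum: "dist x m + dist m y = dist x y" using segment_dist_sum[OF S] .
  obtain c where c: "c 0 = x'" "c (dist x y) = y'" "c ` {0..dist x y} \<subseteq> model_space" "Sxy' = c ` {0..dist x y}"
    "\<And>s t. s \<in> {0..dist x y} \<Longrightarrow> t \<in> {0..dist x y} \<Longrightarrow> model_dist \<kappa> (c s) (c t) = \<bar>s - t\<bar>"
    using geo(1) unfolding geodesic_segment_def d(1) by blast
  define m' where "m' = c (dist x m)"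
  have range: "dist x m \<in> {0..dist x y}" using sum by (smt (verit) atLeastAtMost_iff zero_le_dist)
  have m': "m' \<in> model_space" "m' \<in> Sxy'"
    using range c(3,4) unfolding m'_def by blast+
  have dm': "model_dist \<kappa> x' m' = dist x m" "model_dist \<kappa> m' y' = dist m y"
    using range c(5)[of 0 "dist x m"] c(5)[of "dist x m" "dist x y"] sum
    by (auto simp: m'_def c(1,2))
  have "z' \<in> Syz'"
  proof -
    obtain c where c: "c (dist y z) = z'" "Syz' = c ` {0..dist y z}"
      using geo(2) unfolding geodesic_segment_def d(2) by blast
    have "dist y z \<in> {0..dist y z}" by simp
    then show ?thesis using c by (metis imageI)
  qed
  then have "(z, z') \<in> comparison_pairs \<kappa> y Syz y' Syz'"
    using segment_ends(2)[OF sides(1)] d(2) by (simp add: comparison_pairs_def)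
  moreover have "(m, m') \<in> comparison_pairs \<kappa> x S x' Sxy'"
    using S(2) m' dm' by (simp add: comparison_pairs_def)
  ultimately have "dist m z \<le> model_dist \<kappa> m' z'"
    using le unfolding Let_def by blast
  then have cos_le: "m' \<bullet> z' \<le> cos (sqrt \<kappa> * dist m z)"
    using cos_model_dist[OF \<kappa> m'(1) pts(3)] \<kappa>
      cos_monotone_0_pi_le[of "sqrt \<kappa> * dist m z" "sqrt \<kappa> * model_dist \<kappa> m' z'"]
    by simp
  have sin_nonneg: "0 \<le> sin (sqrt \<kappa> * dist x y)"
    using cos_model_dist(2,3)[OF \<kappa> pts(1,2)] d(1) by (intro sin_ge_zero) auto
  have split: "sqrt \<kappa> * dist x y = sqrt \<kappa> * dist x m + sqrt \<kappa> * dist m y"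
    using sum by (metis distrib_left)
  have "sin (sqrt \<kappa> * dist x y) *\<^sub>R m' = sin (sqrt \<kappa> * dist m y) *\<^sub>R x' + sin (sqrt \<kappa> * dist x m) *\<^sub>R y'"
    unfolding split
  proof (rule great_circle_point)
    show "x' \<bullet> x' = 1" "y' \<bullet> y' = 1" "m' \<bullet> m' = 1" using pts m' by (auto simp: dot_square_norm)
    show "x' \<bullet> m' = cos (sqrt \<kappa> * dist x m)" "m' \<bullet> y' = cos (sqrt \<kappa> * dist m y)"
      using cos_model_dist(1)[OF \<kappa> pts(1) m'(1)] cos_model_dist(1)[OF \<kappa> m'(1) pts(2)] dm' by auto
    show "x' \<bullet> y' = cos (sqrt \<kappa> * dist x m + sqrt \<kappa> * dist m y)"
      using cos_model_dist(1)[OF \<kappa> pts(1,2)] d(1) split by simp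
  qed
  then have "sin (sqrt \<kappa> * dist x y) * (m' \<bullet> z')
      = sin (sqrt \<kappa> * dist m y) * (x' \<bullet> z') + sin (sqrt \<kappa> * dist x m) * (y' \<bullet> z')"
    by (metis inner_add_left inner_scaleR_left)
  moreover have "x' \<bullet> z' = cos (sqrt \<kappa> * dist x z)" "y' \<bullet> z' = cos (sqrt \<kappa> * dist y z)"
    using cos_model_dist(1)[OF \<kappa> pts(3,1)] cos_model_dist(1)[OF \<kappa> pts(2,3)] d
    by (auto simp: inner_commute dist_commute)
  ultimately show ?thesis
    using mult_left_mono[OF cos_le sin_nonneg] by simp
qed

text \<open>
  After scaling by \<open>sqrt \<kappa>\<close>, the cosine inequality bounds the cosine of the distance from \<open>m\<close> to \<open>z\<close> from below by
  the spherical interpolation of the cosines at \<open>x\<close> and \<open>y\<close>, which in turn dominates the cosine of the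
  square root of the right-hand side.
\<close>

lemma small_CAT_square_convex:
  fixes x y z m :: "'a::metric_space"
  assumes \<kappa>: "\<kappa> > 0" and CAT: "CAT_space \<kappa> TYPE('a)"
    and L: "0 < L" "L < pi / 2" and small: "\<And>x y :: 'a. sqrt \<kappa> * dist x y \<le> L"
    and k: "0 \<le> k" "k < 1" and modulus: "k * sin L \<le> L * cos L"
    and S: "segment x y S" "m \<in> S" and t: "dist x m = t * dist x y" "0 \<le> t" "t \<le> 1"
  shows "(dist m z)\<^sup>2 \<le> (1 - t) * (dist x z)\<^sup>2 + t * (dist y z)\<^sup>2 - k * (t * (1 - t) * (dist x y)\<^sup>2)"
proof (cases "x = y")
  case True
  then have "m = x" using t(1) by simp
  then show ?thesis using True by (simp add: left_diff_distrib)
next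
  case False
  define a b c where "a = sqrt \<kappa> * dist x y" and "b = sqrt \<kappa> * dist x z" and "c = sqrt \<kappa> * dist y z"
  have s: "0 < sqrt \<kappa>" using \<kappa> by simp
  have d_lt: "2 * dist p q < pi / sqrt \<kappa>" for p q :: 'a
    using small[of p q] L s by (simp add: field_simps)
  have "dist x m + dist m y = dist x y" by (rule segment_dist_sum[OF S])
  then have dmy: "dist m y = (1 - t) * dist x y" using t(1) by (simp add: left_diff_distrib)
  have "dist x y + dist y z + dist z x < 2 * (pi / sqrt \<kappa>)"
    using d_lt[of x y] d_lt[of y z] d_lt[of z x] zero_le_dist[of x y] by linarith
  moreover have "dist y z < pi / sqrt \<kappa>" "dist z x < pi / sqrt \<kappa>"
    using d_lt[of y z] d_lt[of z x] zero_le_dist[of y z] zero_le_dist[of z x] by linarith+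
  ultimately have ge: "sin ((1 - t) * a) * cos b + sin (t * a) * cos c \<le> sin a * cos (sqrt \<kappa> * dist m z)"
    using CAT_cosine_inequality[OF \<kappa> CAT S, of z] unfolding dmy t(1) a_def b_def c_def
    by (simp only: mult.left_commute[of "sqrt \<kappa>"])
  define h where "h = (1 - t) * b\<^sup>2 + t * c\<^sup>2 - k * (t * (1 - t) * a\<^sup>2)"
  have *: "0 \<le> b" "b \<le> L" "0 \<le> c" "c \<le> L" "0 < a" "a < pi" "a \<le> b + c"
  proof -
    show "0 \<le> b" "b \<le> L" "0 \<le> c" "c \<le> L" "0 < a"
      using small s False by (auto simp: a_def b_def c_def)
    show "a < pi" using small[of x y] L by (simp add: a_def b_def c_def)
    have "dist x y \<le> dist x z + dist y z" by (metis dist_triangle dist_commute)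
    then show "a \<le> b + c" using s by (simp add: a_def b_def c_def flip: distrib_left)
  qed
  have m: "k * sin q \<le> q * cos q" if "0 \<le> q" "q \<le> L" for q
    using mult_sin_le_mult_cos[of L k q] L k modulus that by simp
  note cmp = cos_sqrt_le_spherical_interpolation[OF k L m *(1-7) t(2,3), folded h_def]
  have "sin a * cos (sqrt h) \<le> sin a * cos (sqrt \<kappa> * dist m z)"
    using cmp(3) ge by simp
  moreover have "0 < sin a" using * by (intro sin_gt_zero) auto
  ultimately have "cos (sqrt h) \<le> cos (sqrt \<kappa> * dist m z)" by simp
  moreover have "sqrt h \<le> L" using cmp(2) L by (simp add: real_le_lsqrt)
  moreover have "sqrt \<kappa> * dist m z \<le> L" "0 \<le> sqrt \<kappa> * dist m z" "0 \<le> sqrt h"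
    using small[of m z] s cmp(1) by auto
  ultimately have "sqrt \<kappa> * dist m z \<le> sqrt h"
    using cos_mono_le_eq[of "sqrt h" "sqrt \<kappa> * dist m z"] L by linarith
  then have "(sqrt \<kappa> * dist m z)\<^sup>2 \<le> (sqrt h)\<^sup>2"
    using s by (intro power_mono) auto
  then have "(sqrt \<kappa> * dist m z)\<^sup>2 \<le> h"
    using cmp(1) by simp
  moreover have "h = \<kappa> * ((1 - t) * (dist x z)\<^sup>2 + t * (dist y z)\<^sup>2 - k * (t * (1 - t) * (dist x y)\<^sup>2))"
    unfolding h_def a_def b_def c_def power_mult_distrib real_sqrt_pow2[OF less_imp_le[OF \<kappa>]] by (simp add: algebra_simps)
  ultimately show ?thesis using \<kappa> by (simp add: power_mult_distrib)
qed

section \<open>Asymptotic centers in spaces with strongly convex squared distance\<close>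

lemma infdist_attained:
  assumes "compact C" "C \<noteq> {}"
  obtains w where "w \<in> C" "infdist x C = dist x w"
proof -
  obtain w where w: "w \<in> C" "\<And>y. y \<in> C \<Longrightarrow> dist x w \<le> dist x y"
    using continuous_attains_inf[OF assms, of "dist x"] continuous_on_dist[OF continuous_on_const continuous_on_id]
    by blast
  have "infdist x C = dist x w"
    unfolding infdist_notempty[OF assms(2)] using w by (intro cInf_eq_minimum) auto
  with w(1) that show ?thesis by blast
qed

text \<open>
  For the theory of asymptotic centers the curvature bound matters only through the strong
  convexity of squared distances.
\<close>

locale geodesic_square_convex =
  fixes k :: real and X :: "'a::complete_space itself"
  assumes k_pos: "0 < k"
    and bounded_space: "bounded (UNIV :: 'a set)"
    and segment_exists: "\<exists>S. segment (x :: 'a) y S"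
    and square_convex: "segment (x :: 'a) y S \<Longrightarrow> m \<in> S \<Longrightarrow> dist x m = t * dist x y \<Longrightarrow>
      0 \<le> t \<Longrightarrow> t \<le> 1 \<Longrightarrow>
      (dist m z)\<^sup>2 \<le> (1 - t) * (dist x z)\<^sup>2 + t * (dist y z)\<^sup>2 - k * (t * (1 - t) * (dist x y)\<^sup>2)"
begin

lemma midpoint_exists:
  obtains S m where "segment (x :: 'a) y S" "m \<in> S" "dist x m = 1 / 2 * dist x y"
proof -
  obtain S where S: "segment x y S" using segment_exists by blast
  obtain m where "m \<in> S" "dist x m = 1 / 2 * dist x y" by (rule segment_point[OF S, of "1/2"]) auto
  with S that show ?thesis by blast
qed

text \<open>
  If \<open>m\<close> and \<open>m'\<close> were different, their midpoint would be strictly closer to both \<open>x\<close> and \<open>y\<close>, contrary to the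
  triangle inequality.
\<close>

lemma segment_point_unique:
  fixes x y m m' :: 'a
  assumes m: "dist m x = t * dist x y" "dist m y = (1 - t) * dist x y"
    and m': "dist m' x = t * dist x y" "dist m' y = (1 - t) * dist x y"
  shows "m = m'"
proof (rule ccontr)
  assume "m \<noteq> m'"
  obtain S n where n: "segment m m' S" "n \<in> S" "dist m n = 1 / 2 * dist m m'"
    by (rule midpoint_exists)
  have closer: "dist n z < r" if "dist m z = r" "dist m' z = r" for z r
  proof (rule power2_less_imp_less)
    have "(dist n z)\<^sup>2 \<le> r\<^sup>2 - k / 4 * (dist m m')\<^sup>2"
      using square_convex[OF n, of z] that by simp
    also have "\<dots> < r\<^sup>2" using k_pos \<open>m \<noteq> m'\<close> by simp
    finally show "(dist n z)\<^sup>2 < r\<^sup>2" .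
    show "0 \<le> r" using that by auto
  qed
  have "dist x y \<le> dist n x + dist n y" by (rule dist_triangle3)
  also have "\<dots> < t * dist x y + (1 - t) * dist x y"
    using closer[of x] closer[of y] m m' by (intro add_strict_mono) auto
  finally show False by (simp add: algebra_simps)
qed

lemma geodesic_comb_on_segment:
  fixes x y :: 'a
  assumes t: "0 \<le> t" "t \<le> 1"
  obtains S where "segment x y S" "geodesic_comb t x y \<in> S" "dist x (geodesic_comb t x y) = t * dist x y"
proof -
  obtain S where S: "segment x y S" using segment_exists by blast
  obtain m where m: "m \<in> S" "dist x m = t * dist x y" "dist m y = (1 - t) * dist x y"
    by (rule segment_point[OF S t])
  have "\<exists>S. segment x y S \<and> geodesic_comb t x y \<in> S \<and>
      dist (geodesic_comb t x y) x = t * dist x y \<and> dist (geodesic_comb t x y) y = (1 - t) * dist x y"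
    unfolding geodesic_comb_def
  proof (rule theI)
    show "\<exists>S. segment x y S \<and> m \<in> S \<and> dist m x = t * dist x y \<and> dist m y = (1 - t) * dist x y"
      using S m by (auto simp: dist_commute)
    show "z = m" if "\<exists>S. segment x y S \<and> z \<in> S \<and> dist z x = t * dist x y \<and> dist z y = (1 - t) * dist x y" for z
      using that m by (intro segment_point_unique[of z x t y m]) (auto simp: dist_commute)
  qed
  then show ?thesis using that by (metis dist_commute)
qed

lemma geodesic_comb_square_convex:
  fixes x y z :: 'a
  assumes t: "0 \<le> t" "t \<le> 1"
  shows "(dist (geodesic_comb t x y) z)\<^sup>2
    \<le> (1 - t) * (dist x z)\<^sup>2 + t * (dist y z)\<^sup>2 - k * (t * (1 - t) * (dist x y)\<^sup>2)"
  by (rule geodesic_comb_on_segment[OF t, of x y]) (rule square_convex, use t in auto)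

text \<open>
  Strong convexity at midpoints bounds the distance of two almost minimizing points by the excess of their
  values over the infimum, so minimizing sequences are Cauchy. Applied to squared distances this gives
  metric projections, applied to squared asymptotic radii it gives asymptotic centers.
\<close>

lemma ex1_minimizer:
  fixes F :: "'a \<Rightarrow> real"
  assumes K: "K \<noteq> {}" "closed K" "geodesically_convex K"
    and cont: "continuous_on K F" and bdd: "\<And>x. x \<in> K \<Longrightarrow> b \<le> F x"
    and mid: "\<And>x y S m. x \<in> K \<Longrightarrow> y \<in> K \<Longrightarrow> segment x y S \<Longrightarrow> m \<in> S \<Longrightarrow>
      dist x m = 1 / 2 * dist x y \<Longrightarrow> F m \<le> (F x + F y) / 2 - k / 4 * (dist x y)\<^sup>2"
  shows "\<exists>!p. p \<in> K \<and> (\<forall>q\<in>K. F p \<le> F q)"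
proof -
  define I where "I = (INF x\<in>K. F x)"
  have bdd': "bdd_below (F ` K)" using bdd by (auto intro!: bdd_belowI)
  have I_le: "I \<le> F x" if "x \<in> K" for x
    unfolding I_def using that bdd' by (rule cINF_lower[rotated])
  have close: "k / 4 * (dist x y)\<^sup>2 \<le> e" if xy: "x \<in> K" "y \<in> K" "F x \<le> I + e" "F y \<le> I + e" for x y e
  proof -
    obtain S m where m: "segment x y S" "m \<in> S" "dist x m = 1 / 2 * dist x y" by (rule midpoint_exists)
    have "m \<in> K" using m K(3) xy unfolding geodesically_convex_def by blast
    then show ?thesis using mid[OF xy(1,2) m] I_le[OF \<open>m \<in> K\<close>] xy(3,4) by argo
  qed
  have "\<exists>x\<in>K. F x < I + 1 / Suc n" for n
    using cInf_lessD[of "F ` K" "I + 1 / Suc n"] K(1) by (auto simp: I_def)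
  then obtain s where s: "\<And>n. s n \<in> K" "\<And>n. F (s n) < I + 1 / Suc n" by metis
  have "Cauchy s"
  proof (rule metric_CauchyI)
    fix e :: real assume "0 < e"
    then have "0 < k / 4 * e\<^sup>2" using k_pos by simp
    then obtain N where N: "1 / Suc N < k / 4 * e\<^sup>2"
      using reals_Archimedean by (metis inverse_eq_divide)
    have "dist (s m) (s n) < e" if "N \<le> m" "N \<le> n" for m n
    proof -
      have le: "F (s j) \<le> I + 1 / Suc N" if "N \<le> j" for j
      proof -
        have "1 / real (Suc j) \<le> 1 / real (Suc N)" using that by (simp add: frac_le)
        then show ?thesis using s(2)[of j] by simp
      qed
      have "k / 4 * (dist (s m) (s n))\<^sup>2 \<le> 1 / Suc N"
        using that by (intro close s le)
      then have "k / 4 * (dist (s m) (s n))\<^sup>2 < k / 4 * e\<^sup>2" using N by simp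
      then have "(dist (s m) (s n))\<^sup>2 < e\<^sup>2" using k_pos by simp
      then show ?thesis using \<open>0 < e\<close> by (simp add: power2_less_imp_less)
    qed
    then show "\<exists>M. \<forall>m\<ge>M. \<forall>n\<ge>M. dist (s m) (s n) < e" by blast
  qed
  then obtain p where p: "s \<longlonglongrightarrow> p" using Cauchy_convergent_iff convergent_def by blast
  have pK: "p \<in> K" using closed_sequentially[OF K(2)] s(1) p by blast
  have "(\<lambda>n. F (s n)) \<longlonglongrightarrow> F p"
    using cont p pK s(1) unfolding continuous_on_sequentially comp_def by blast
  moreover have "(\<lambda>n. I + 1 / real (Suc n)) \<longlonglongrightarrow> I + 0"
    by (intro tendsto_add tendsto_const LIMSEQ_Suc[OF lim_1_over_n])
  ultimately have "F p \<le> I"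
    using s(2) by (intro LIMSEQ_le[of "\<lambda>n. F (s n)" _ "\<lambda>n. I + 1 / real (Suc n)"]) (auto intro: less_imp_le)
  then have min: "p \<in> K \<and> (\<forall>q\<in>K. F p \<le> F q)" using pK I_le by force
  moreover have "q = p" if "q \<in> K \<and> (\<forall>r\<in>K. F q \<le> F r)" for q
  proof -
    have "F q \<le> I" using that \<open>F p \<le> I\<close> pK by force
    then have "k / 4 * (dist q p)\<^sup>2 \<le> 0"
      using close[of q p 0] that pK \<open>F p \<le> I\<close> by simp
    then show ?thesis using k_pos by (simp add: mult_le_0_iff)
  qed
  ultimately show ?thesis by blast
qed

lemma metric_proj_nearest:
  fixes x :: 'a
  assumes K: "K \<noteq> {}" "closed K" "geodesically_convex K"
  shows "metric_proj K x \<in> K" "q \<in> K \<Longrightarrow> dist x (metric_proj K x) \<le> dist x q"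
proof -
  have "\<exists>!p. p \<in> K \<and> (\<forall>q\<in>K. (dist x p)\<^sup>2 \<le> (dist x q)\<^sup>2)"
  proof (rule ex1_minimizer[OF K, where b = 0])
    show "continuous_on K (\<lambda>p. (dist x p)\<^sup>2)" by (intro continuous_intros)
    fix p q m :: 'a and S assume "segment p q S" "m \<in> S" "dist p m = 1 / 2 * dist p q"
    from square_convex[OF this, of x]
    show "(dist x m)\<^sup>2 \<le> ((dist x p)\<^sup>2 + (dist x q)\<^sup>2) / 2 - k / 4 * (dist p q)\<^sup>2"
      by (simp add: dist_commute field_simps)
  qed simp
  then have "\<exists>!p. p \<in> K \<and> (\<forall>q\<in>K. dist x p \<le> dist x q)" by (simp add: abs_le_square_iff[symmetric])
  from theI'[OF this] show "metric_proj K x \<in> K" "q \<in> K \<Longrightarrow> dist x (metric_proj K x) \<le> dist x q"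
    unfolding metric_proj_def by blast+
qed

text \<open>
  In a bounded space asymptotic radii are finite; as real numbers they can be squared and subtracted.
\<close>

definition arad :: "(nat \<Rightarrow> 'a) \<Rightarrow> 'a \<Rightarrow> real" where
  "arad s x = real_of_ereal (asymptotic_radius_at x s)"

lemma dist_bound: "\<exists>B. \<forall>x y :: 'a. dist x y \<le> B"
  using bounded_space unfolding bounded_two_points by auto

lemma asymptotic_radius_at_eq: "asymptotic_radius_at x s = ereal (arad s x)"
  and arad_nonneg: "0 \<le> arad s x"
proof -
  obtain B where B: "\<forall>x y :: 'a. dist x y \<le> B" using dist_bound by blast
  have "asymptotic_radius_at x s \<le> ereal B"
    unfolding asymptotic_radius_at_def by (rule Limsup_bounded) (simp add: B)
  moreover have "0 \<le> asymptotic_radius_at x s"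
    unfolding asymptotic_radius_at_def by (rule le_Limsup) auto
  ultimately show "asymptotic_radius_at x s = ereal (arad s x)" "0 \<le> arad s x"
    unfolding arad_def by (cases "asymptotic_radius_at x s"; simp)+
qed

lemma arad_less: "arad s x < b \<Longrightarrow> \<forall>\<^sub>F n in sequentially. dist x (s n) < b"
  using Limsup_lessD[of sequentially "\<lambda>n. ereal (dist x (s n))" "ereal b"]
  by (simp flip: asymptotic_radius_at_def add: asymptotic_radius_at_eq)

lemma arad_le: "\<forall>\<^sub>F n in sequentially. dist x (s n) \<le> b \<Longrightarrow> arad s x \<le> b"
  using Limsup_bounded[of "\<lambda>n. ereal (dist x (s n))" "ereal b" sequentially]
  by (simp flip: asymptotic_radius_at_def add: asymptotic_radius_at_eq)

lemma arad_mono: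
  assumes "\<forall>\<^sub>F n in sequentially. dist x (s n) \<le> dist y (s n)"
  shows "arad s x \<le> arad s y"
proof (rule dense_ge)
  fix b assume "arad s y < b"
  from arad_less[OF this] assms
  have "\<forall>\<^sub>F n in sequentially. dist x (s n) \<le> b" by eventually_elim simp
  then show "arad s x \<le> b" by (rule arad_le)
qed

lemma arad_tendsto:
  assumes "(\<lambda>n. dist x (s n)) \<longlonglongrightarrow> l"
  shows "arad s x = l"
proof -
  have "limsup (\<lambda>n. ereal (dist x (s n))) = ereal l"
    using assms by (intro lim_imp_Limsup) auto
  then show ?thesis by (simp add: arad_def asymptotic_radius_at_def)
qed

lemma arad_subseq:
  assumes "strict_mono \<phi>"
  shows "arad (s \<circ> \<phi>) x \<le> arad s x"
proof (rule dense_ge)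
  fix b assume "arad s x < b"
  from eventually_subseq[OF assms arad_less[OF this]]
  show "arad (s \<circ> \<phi>) x \<le> b" by (intro arad_le) (auto elim: eventually_mono)
qed

lemma arad_shift: "arad (s \<circ> (+) j) x = arad s x"
proof (rule antisym)
  show "arad (s \<circ> (+) j) x \<le> arad s x" by (rule arad_subseq) (simp add: strict_mono_def)
  show "arad s x \<le> arad (s \<circ> (+) j) x"
  proof (rule dense_ge)
    fix b assume "arad (s \<circ> (+) j) x < b"
    from arad_less[OF this] have "\<forall>\<^sub>F n in sequentially. dist x (s (n + j)) < b"
      by (simp add: add.commute)
    then have "\<forall>\<^sub>F n in sequentially. dist x (s n) < b"
      by (simp add: eventually_sequentially_seg[of "\<lambda>n. dist x (s n) < b"])
    then show "arad s x \<le> b" by (intro arad_le) (auto elim: eventually_mono)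
  qed
qed

lemma arad_triangle: "arad s x \<le> arad s y + dist x y"
proof (rule dense_ge)
  fix b assume "arad s y + dist x y < b"
  then have "arad s y < b - dist x y" by simp
  from arad_less[OF this]
  have "\<forall>\<^sub>F n in sequentially. dist x (s n) \<le> b"
  proof eventually_elim
    case (elim n)
    then show ?case using dist_triangle[of x "s n" y] by simp
  qed
  then show "arad s x \<le> b" by (rule arad_le)
qed

lemma continuous_on_arad: "continuous_on A (arad s)"
proof (rule continuous_on_subset[OF _ subset_UNIV], rule uniformly_continuous_imp_continuous)
  have "\<bar>arad s x - arad s y\<bar> \<le> dist x y" for x y
    using arad_triangle[of s x y] arad_triangle[of s y x] by (simp add: dist_commute abs_le_iff)
  then show "uniformly_continuous_on UNIV (arad s)"
    unfolding uniformly_continuous_on_def by (metis dist_commute dist_real_def order_le_less_trans)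
qed

text \<open>
  The inequality holds for the distances to every \<open>s n\<close> and survives the upper limit; since upper limits
  are only subadditive, the radii at \<open>x\<close> and \<open>y\<close> are first enlarged by \<open>e\<close>, and then \<open>e\<close> tends to \<open>0\<close>.
\<close>

lemma arad_square_convex:
  fixes x y m :: 'a
  assumes m: "segment x y S" "m \<in> S" "dist x m = t * dist x y" and t: "0 \<le> t" "t \<le> 1"
  shows "(arad s m)\<^sup>2 \<le> (1 - t) * (arad s x)\<^sup>2 + t * (arad s y)\<^sup>2 - k * (t * (1 - t) * (dist x y)\<^sup>2)"
proof -
  define R where "R = (\<lambda>e. (1 - t) * (arad s x + e)\<^sup>2 + t * (arad s y + e)\<^sup>2 - k * (t * (1 - t) * (dist x y)\<^sup>2))"
  have "(arad s m)\<^sup>2 \<le> R e" if "0 < e" for e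
  proof -
    have "\<forall>\<^sub>F n in sequentially. dist x (s n) < arad s x + e" "\<forall>\<^sub>F n in sequentially. dist y (s n) < arad s y + e"
      using that by (auto intro!: arad_less)
    then have ev: "\<forall>\<^sub>F n in sequentially. (dist m (s n))\<^sup>2 \<le> R e"
    proof eventually_elim
      case (elim n)
      then have "(dist x (s n))\<^sup>2 \<le> (arad s x + e)\<^sup>2" "(dist y (s n))\<^sup>2 \<le> (arad s y + e)\<^sup>2"
        by (auto intro!: power_mono)
      then have "(1 - t) * (dist x (s n))\<^sup>2 + t * (dist y (s n))\<^sup>2
          \<le> (1 - t) * (arad s x + e)\<^sup>2 + t * (arad s y + e)\<^sup>2"
        using t by (intro add_mono mult_left_mono) auto
      then show ?case using square_convex[OF m t, of "s n"] by (simp add: R_def)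
    qed
    then have "0 \<le> R e" using eventually_happens'[OF _ ev] by (force intro: order_trans[OF zero_le_power2])
    moreover have "arad s m \<le> sqrt (R e)"
      using ev by (intro arad_le) (auto elim!: eventually_mono intro: real_le_rsqrt)
    ultimately show ?thesis using arad_nonneg[of s m] by (metis real_sqrt_pow2 power_mono)
  qed
  then have "\<forall>\<^sub>F e in at_right 0. (arad s m)\<^sup>2 \<le> R e"
    by (auto simp: eventually_at_right_less intro: eventually_mono[OF eventually_at_right_less])
  moreover have "(R \<longlongrightarrow> R 0) (at_right 0)" unfolding R_def by (intro tendsto_eq_intros) auto
  ultimately have "(arad s m)\<^sup>2 \<le> R 0" by (intro tendsto_lowerbound) auto
  then show ?thesis by (simp add: R_def)
qed

lemma asymptotic_center_iff: "x \<in> asymptotic_center s \<longleftrightarrow> (\<forall>y. arad s x \<le> arad s y)"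
proof -
  have "x \<in> asymptotic_center s \<longleftrightarrow> asymptotic_radius_at x s \<le> asymptotic_radius s"
    unfolding asymptotic_center_def asymptotic_radius_def by (auto intro: antisym INF_lower)
  also have "\<dots> \<longleftrightarrow> (\<forall>y. asymptotic_radius_at x s \<le> asymptotic_radius_at y s)"
    unfolding asymptotic_radius_def by (simp add: le_INF_iff)
  finally show ?thesis by (simp add: asymptotic_radius_at_eq)
qed

lemma asymptotic_center_singleton:
  fixes s :: "nat \<Rightarrow> 'a"
  shows "\<exists>z. asymptotic_center s = {z}"
proof -
  have "\<exists>!z. z \<in> UNIV \<and> (\<forall>y\<in>UNIV. (arad s z)\<^sup>2 \<le> (arad s y)\<^sup>2)"
  proof (rule ex1_minimizer[where b = 0])
    show "geodesically_convex (UNIV :: 'a set)" by (simp add: geodesically_convex_def)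
    show "continuous_on UNIV (\<lambda>z. (arad s z)\<^sup>2)" by (intro continuous_intros continuous_on_arad)
    fix p q m :: 'a and S assume "segment p q S" "m \<in> S" "dist p m = 1 / 2 * dist p q"
    from arad_square_convex[OF this, of s]
    show "(arad s m)\<^sup>2 \<le> ((arad s p)\<^sup>2 + (arad s q)\<^sup>2) / 2 - k / 4 * (dist p q)\<^sup>2"
      by (simp add: field_simps)
  qed auto
  then have "\<exists>!z. z \<in> asymptotic_center s"
    by (simp add: asymptotic_center_iff abs_le_square_iff[symmetric] arad_nonneg)
  then show ?thesis by auto
qed

definition rad :: "(nat \<Rightarrow> 'a) \<Rightarrow> real" where
  "rad s = (INF x. arad s x)"

lemma rad_le: "rad s \<le> arad s x"
  unfolding rad_def by (rule cINF_lower) (auto intro!: bdd_belowI[of _ 0] arad_nonneg)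

lemma rad_greatest: "(\<And>x. b \<le> arad s x) \<Longrightarrow> b \<le> rad s"
  unfolding rad_def by (rule cINF_greatest) auto

lemma rad_center: "z \<in> asymptotic_center s \<Longrightarrow> arad s z = rad s"
  by (auto simp: asymptotic_center_iff intro!: antisym rad_greatest rad_le)

lemma rad_subseq: "strict_mono \<phi> \<Longrightarrow> rad (s \<circ> \<phi>) \<le> rad s"
  by (intro rad_greatest order_trans[OF rad_le arad_subseq])

definition regular :: "(nat \<Rightarrow> 'a) \<Rightarrow> bool" where
  "regular s \<longleftrightarrow> (\<forall>\<phi>. strict_mono \<phi> \<longrightarrow> rad s \<le> rad (s \<circ> \<phi>))"

text \<open>
  A diagonal argument: subsequences are extracted repeatedly, the \<open>n\<close>-th one with asymptotic radius within
  \<open>1/(n+1)\<close> of the infimum over all further subsequences. This property is inherited by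
  subsequences, hence the diagonal sequence, from index \<open>n+1\<close> on, has it for every \<open>n\<close>.
\<close>

lemma regular_subsequence_exists:
  obtains \<psi> :: "nat \<Rightarrow> nat" where "strict_mono \<psi>" "regular (s \<circ> \<psi>)"
proof -
  define P where "P = (\<lambda>n (r :: nat \<Rightarrow> nat). \<forall>\<phi>. strict_mono \<phi> \<longrightarrow> rad (s \<circ> r) - 1 / real (Suc n) \<le> rad (s \<circ> r \<circ> \<phi>))"
  interpret subseqs P
  proof
    fix n and r :: "nat \<Rightarrow> nat" assume r: "strict_mono r"
    define A where "A = (\<lambda>\<phi>. rad (s \<circ> r \<circ> \<phi>)) ` {\<phi> :: nat \<Rightarrow> nat. strict_mono \<phi>}"
    have "id \<in> {\<phi> :: nat \<Rightarrow> nat. strict_mono \<phi>}" by (simp add: strict_mono_def)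
    then have "A \<noteq> {}" unfolding A_def by blast
    moreover have bdd: "bdd_below A"
      unfolding A_def by (intro bdd_belowI[of _ 0]) (auto intro!: rad_greatest arad_nonneg)
    ultimately obtain v where "v \<in> A" "v < Inf A + 1 / Suc n"
      using cInf_lessD[of A "Inf A + 1 / Suc n"] by auto
    then obtain \<phi> :: "nat \<Rightarrow> nat" where \<phi>: "strict_mono \<phi>" "rad (s \<circ> r \<circ> \<phi>) < Inf A + 1 / Suc n"
      unfolding A_def by blast
    have "P n (r \<circ> \<phi>)"
      unfolding P_def
    proof (intro allI impI)
      fix \<phi>' :: "nat \<Rightarrow> nat" assume "strict_mono \<phi>'"
      then have "rad (s \<circ> r \<circ> (\<phi> \<circ> \<phi>')) \<in> A"
        unfolding A_def using \<phi>(1) strict_mono_o by blast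
      then have "Inf A \<le> rad (s \<circ> r \<circ> (\<phi> \<circ> \<phi>'))" using bdd by (rule cInf_lower)
      then show "rad (s \<circ> (r \<circ> \<phi>)) - 1 / real (Suc n) \<le> rad (s \<circ> (r \<circ> \<phi>) \<circ> \<phi>')"
        using \<phi>(2) by (simp add: comp_assoc)
    qed
    with \<phi>(1) show "\<exists>r'. strict_mono r' \<and> P n (r \<circ> r')" by blast
  qed
  have stable: "P n (s' \<circ> r)" if r: "strict_mono r" and P: "P n s'" for r s' n
    unfolding P_def
  proof (intro allI impI)
    fix \<phi> :: "nat \<Rightarrow> nat" assume "strict_mono \<phi>"
    then have "rad (s \<circ> s') - 1 / real (Suc n) \<le> rad (s \<circ> s' \<circ> (r \<circ> \<phi>))"
      using P r strict_mono_o unfolding P_def by blast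
    moreover have "rad (s \<circ> s' \<circ> r) \<le> rad (s \<circ> s')" using r by (rule rad_subseq)
    ultimately show "rad (s \<circ> (s' \<circ> r)) - 1 / real (Suc n) \<le> rad (s \<circ> (s' \<circ> r) \<circ> \<phi>)"
      by (simp add: comp_assoc)
  qed
  have rad_shift: "rad (s' \<circ> (+) j) = rad s'" for s' j
    unfolding rad_def arad_shift ..
  have "rad (s \<circ> diagseq) \<le> rad (s \<circ> diagseq \<circ> \<phi>)" if \<phi>: "strict_mono \<phi>" for \<phi>
  proof (rule field_le_epsilon)
    fix e :: real assume "0 < e"
    then obtain j where j: "1 / Suc j < e" using reals_Archimedean by (metis inverse_eq_divide)
    \<comment> \<open>Re-indexing: past index \<open>j\<close>, the subsequence \<open>\<phi>\<close> of the diagonal is a subsequence of its tail.\<close>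
    define \<phi>' where "\<phi>' = (\<lambda>n. \<phi> (Suc j + n) - Suc j)"
    have ge: "Suc j \<le> \<phi> (Suc j + n)" for n
      using seq_suble[OF \<phi>, of "Suc j + n"] by simp
    have "strict_mono \<phi>'"
      unfolding \<phi>'_def strict_mono_def using \<phi> ge by (auto simp: strict_mono_def intro!: diff_less_mono)
    moreover have "P j (diagseq \<circ> (+) (Suc j))"
      by (rule diagseq_holds) (rule stable)
    ultimately have "rad (s \<circ> (diagseq \<circ> (+) (Suc j))) - 1 / real (Suc j)
        \<le> rad (s \<circ> (diagseq \<circ> (+) (Suc j)) \<circ> \<phi>')"
      unfolding P_def by blast
    also have "s \<circ> (diagseq \<circ> (+) (Suc j)) \<circ> \<phi>' = s \<circ> diagseq \<circ> \<phi> \<circ> (+) (Suc j)"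
    proof
      fix n
      have "Suc j + \<phi>' n = \<phi> (Suc j + n)" unfolding \<phi>'_def by (rule le_add_diff_inverse[OF ge])
      then show "(s \<circ> (diagseq \<circ> (+) (Suc j)) \<circ> \<phi>') n = (s \<circ> diagseq \<circ> \<phi> \<circ> (+) (Suc j)) n"
        by (simp only: comp_apply)
    qed
    finally have "rad (s \<circ> diagseq) - 1 / real (Suc j) \<le> rad (s \<circ> diagseq \<circ> \<phi>)"
      unfolding comp_assoc[symmetric] rad_shift .
    then show "rad (s \<circ> diagseq) \<le> rad (s \<circ> diagseq \<circ> \<phi>) + e"
      using j by simp
  qed
  then show ?thesis using that[OF subseq_diagseq] by (simp add: regular_def)
qed

text \<open>
  Nearest points of \<open>C\<close> to the \<open>s n\<close> accumulate at some \<open>p \<in> C\<close>, for which the asymptotic radius \<open>\<rho>\<close> along a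
  subsequence satisfies \<open>\<rho>\<^sup>2 \<le> r\<^sup>2 + q d\<^sup>2(z, C)\<close>. By regularity \<open>z\<close> is still a center of that subsequence, with
  the same radius \<open>r\<close>. If \<open>z \<noteq> p\<close>, then moving from \<open>z\<close> a little towards \<open>p\<close> would lower the radius, because the
  gain \<open>k\<close> from strong convexity exceeds the loss \<open>q\<close>.
\<close>

lemma asymptotic_center_in_compact:
  fixes z :: 'a
  assumes s: "regular s" "z \<in> asymptotic_center s"
    and C: "compact C" "C \<noteq> {}" and q: "0 \<le> q" "q < k"
    and \<eta>: "\<eta> \<longlonglongrightarrow> 0"
    and le: "\<And>n. (infdist (s n) C)\<^sup>2 \<le> (dist z (s n))\<^sup>2 + q * (infdist z C)\<^sup>2 + \<eta> n"
  shows "z \<in> C"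
proof -
  have "\<exists>w\<in>C. infdist (s n) C = dist (s n) w" for n
    using infdist_attained[OF C] by metis
  then obtain w where w: "\<And>n. w n \<in> C" "\<And>n. infdist (s n) C = dist (s n) (w n)" by metis
  obtain p \<phi> where p: "p \<in> C" and \<phi>: "strict_mono \<phi>" and lim: "(w \<circ> \<phi>) \<longlonglongrightarrow> p"
    using C(1) w(1) unfolding compact_def by metis
  define r where "r = arad s z"
  define Q where "Q = q * (infdist z C)\<^sup>2"
  have Q: "0 \<le> Q" using q by (simp add: Q_def)
  have arad_p: "(arad (s \<circ> \<phi>) p)\<^sup>2 \<le> r\<^sup>2 + Q"
  proof -
    define f where "f = (\<lambda>e. sqrt ((r + e)\<^sup>2 + Q + e) + e)"
    have "arad (s \<circ> \<phi>) p \<le> f e" if "0 < e" for e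
    proof (rule arad_le)
      have "\<forall>\<^sub>F n in sequentially. dist z (s n) < r + e"
        using that by (intro arad_less) (simp add: r_def)
      then have "\<forall>\<^sub>F n in sequentially. dist z (s (\<phi> n)) < r + e" by (rule eventually_subseq[OF \<phi>])
      moreover have "\<forall>\<^sub>F n in sequentially. \<eta> n < e" using \<eta> that by (rule order_tendstoD)
      then have "\<forall>\<^sub>F n in sequentially. \<eta> (\<phi> n) < e" by (rule eventually_subseq[OF \<phi>])
      moreover have "\<forall>\<^sub>F n in sequentially. dist ((w \<circ> \<phi>) n) p < e" using lim that by (rule tendstoD)
      ultimately show "\<forall>\<^sub>F n in sequentially. dist p ((s \<circ> \<phi>) n) \<le> f e"
      proof eventually_elim
        case (elim n)
        have "(dist z (s (\<phi> n)))\<^sup>2 \<le> (r + e)\<^sup>2" using elim(1) by (intro power_mono) auto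
        then have "(dist (s (\<phi> n)) (w (\<phi> n)))\<^sup>2 \<le> (r + e)\<^sup>2 + Q + e"
          using le[of "\<phi> n"] elim(2) by (simp add: w(2) Q_def)
        then have "dist (s (\<phi> n)) (w (\<phi> n)) \<le> sqrt ((r + e)\<^sup>2 + Q + e)" by (rule real_le_rsqrt)
        moreover have "dist p (s (\<phi> n)) \<le> dist (w (\<phi> n)) p + dist (s (\<phi> n)) (w (\<phi> n))"
          by (metis dist_commute dist_triangle add.commute)
        ultimately show ?case using elim(3) by (simp add: f_def)
      qed
    qed
    then have "\<forall>\<^sub>F e in at_right 0. arad (s \<circ> \<phi>) p \<le> f e"
      by (auto intro: eventually_mono[OF eventually_at_right_less])
    moreover have "(f \<longlongrightarrow> f 0) (at_right 0)" unfolding f_def by (intro tendsto_intros)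
    ultimately have "arad (s \<circ> \<phi>) p \<le> f 0" by (intro tendsto_lowerbound) auto
    then have "arad (s \<circ> \<phi>) p \<le> sqrt (r\<^sup>2 + Q)" by (simp add: f_def)
    then have "(arad (s \<circ> \<phi>) p)\<^sup>2 \<le> (sqrt (r\<^sup>2 + Q))\<^sup>2"
      by (intro power_mono arad_nonneg)
    then show ?thesis using Q by simp
  qed
  have r_min: "r \<le> arad (s \<circ> \<phi>) y" for y
    using s(1) \<phi> rad_le[of "s \<circ> \<phi>" y] rad_center[OF s(2)] by (fastforce simp: regular_def r_def)
  have r_z: "arad (s \<circ> \<phi>) z \<le> r" unfolding r_def by (rule arad_subseq[OF \<phi>])
  have r0: "0 \<le> r" unfolding r_def by (rule arad_nonneg)
  \<comment> \<open>Any \<open>t\<close> with \<open>k (1 - t) > q\<close> would do.\<close>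
  define t where "t = (1 - q / k) / 2"
  have t: "0 < t" "t < 1" using q k_pos by (auto simp: t_def field_simps)
  obtain S where S: "segment z p S" using segment_exists by blast
  obtain m where m: "m \<in> S" "dist z m = t * dist z p" by (rule segment_point[OF S, of t]) (use t in auto)
  have "r\<^sup>2 \<le> (arad (s \<circ> \<phi>) m)\<^sup>2" using r_min r0 by (intro power_mono)
  also have "\<dots> \<le> (1 - t) * (arad (s \<circ> \<phi>) z)\<^sup>2 + t * (arad (s \<circ> \<phi>) p)\<^sup>2 - k * (t * (1 - t) * (dist z p)\<^sup>2)"
    using S m t by (intro arad_square_convex) auto
  also have "\<dots> \<le> (1 - t) * r\<^sup>2 + t * (r\<^sup>2 + Q) - k * (t * (1 - t) * (dist z p)\<^sup>2)"
    using t r_z arad_p arad_nonneg by (intro diff_right_mono add_mono mult_left_mono power_mono) auto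
  finally have "t * (k * (1 - t) * (dist z p)\<^sup>2) \<le> t * Q" by (simp add: algebra_simps)
  then have "k * (1 - t) * (dist z p)\<^sup>2 \<le> Q" using t by simp
  also have "Q \<le> q * (dist z p)\<^sup>2"
    unfolding Q_def using q p by (intro mult_left_mono power_mono infdist_le infdist_nonneg) auto
  finally have "(k * (1 - t) - q) * (dist z p)\<^sup>2 \<le> 0" by (simp add: left_diff_distrib)
  moreover have "0 < k * (1 - t) - q" using q k_pos by (simp add: t_def field_simps)
  ultimately have "z = p" by (simp add: mult_le_0_iff)
  with p show ?thesis by simp
qed

text \<open>
  At a point of \<open>F\<close> all subsequences have the same asymptotic radius. Hence the center of a regular
  subsequence of a subsequence, being in \<open>F\<close>, is also the center of that subsequence, and the
  centers of two subsequences can be compared through the whole sequence.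
\<close>

lemma Delta_convergent_if_Fejer:
  fixes s :: "nat \<Rightarrow> 'a"
  assumes conv: "\<And>p. p \<in> F \<Longrightarrow> convergent (\<lambda>n. dist p (s n))"
    and demi: "\<And>\<psi> z. strict_mono \<psi> \<Longrightarrow> regular (s \<circ> \<psi>) \<Longrightarrow> z \<in> asymptotic_center (s \<circ> \<psi>) \<Longrightarrow> z \<in> F"
  shows "\<exists>z. Delta_convergent_to s z \<and> z \<in> F"
proof -
  have same: "arad (s \<circ> \<phi>) p = arad s p" if p: "p \<in> F" and \<phi>: "strict_mono \<phi>" for p \<phi>
  proof -
    obtain l where l: "(\<lambda>n. dist p (s n)) \<longlonglongrightarrow> l" using conv[OF p] unfolding convergent_def by blast
    have "(\<lambda>n. dist p ((s \<circ> \<phi>) n)) \<longlonglongrightarrow> l"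
      using LIMSEQ_subseq_LIMSEQ[OF l \<phi>] by (simp add: comp_def)
    then show ?thesis using arad_tendsto l by metis
  qed
  have center: "\<exists>z\<in>F. z \<in> asymptotic_center (s \<circ> \<phi>)" if \<phi>: "strict_mono \<phi>" for \<phi>
  proof -
    obtain \<psi> where \<psi>: "strict_mono \<psi>" "regular (s \<circ> \<phi> \<circ> \<psi>)" by (rule regular_subsequence_exists)
    obtain z where z: "z \<in> asymptotic_center (s \<circ> \<phi> \<circ> \<psi>)" using asymptotic_center_singleton by blast
    have \<phi>\<psi>: "strict_mono (\<phi> \<circ> \<psi>)" using \<phi> \<psi>(1) by (rule strict_mono_o)
    have zF: "z \<in> F" using demi[OF \<phi>\<psi>] \<psi>(2) z by (simp add: comp_assoc)
    have "arad (s \<circ> \<phi>) z \<le> arad (s \<circ> \<phi>) y" for y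
    proof -
      have "arad (s \<circ> \<phi>) z = arad (s \<circ> \<phi> \<circ> \<psi>) z"
        using same[OF zF \<phi>] same[OF zF \<phi>\<psi>] by (simp add: comp_assoc)
      also have "\<dots> \<le> arad (s \<circ> \<phi> \<circ> \<psi>) y" using z by (simp add: asymptotic_center_iff)
      also have "\<dots> \<le> arad (s \<circ> \<phi>) y" by (rule arad_subseq[OF \<psi>(1)])
      finally show ?thesis .
    qed
    then show ?thesis using zF by (auto simp: asymptotic_center_iff)
  qed
  obtain z where z: "z \<in> F" "z \<in> asymptotic_center s"
    using center[of id] by (auto simp: strict_mono_def)
  have "asymptotic_center (s \<circ> \<phi>) = {z}" if \<phi>: "strict_mono \<phi>" for \<phi>
  proof -
    obtain z' where z': "z' \<in> F" "z' \<in> asymptotic_center (s \<circ> \<phi>)" using center[OF \<phi>] by blast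
    have "arad s z \<le> arad s z'" using z(2) by (simp add: asymptotic_center_iff)
    then have "arad (s \<circ> \<phi>) z \<le> arad (s \<circ> \<phi>) z'" using same[OF z(1) \<phi>] same[OF z'(1) \<phi>] by simp
    then have "z \<in> asymptotic_center (s \<circ> \<phi>)"
      using z'(2) by (auto simp: asymptotic_center_iff intro: order_trans)
    then show ?thesis using asymptotic_center_singleton[of "s \<circ> \<phi>"] by auto
  qed
  moreover have "bounded (range s)" using bounded_space by (rule bounded_subset) simp
  ultimately show ?thesis using z(1) unfolding Delta_convergent_to_def by blast
qed

end

section \<open>Metric projections in small CAT(\<open>\<kappa>\<close>) spaces\<close>

locale small_CAT_space =
  fixes \<kappa> L k :: real and X :: "'a::complete_space itself"
  assumes \<kappa>_pos: "0 < \<kappa>" and CAT: "CAT_space \<kappa> X"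
    and L: "0 < L" "L < pi / 2"
    and bounded_UNIV: "bounded (UNIV :: 'a set)"
    and small: "sqrt \<kappa> * dist (x :: 'a) y \<le> L"
    and k: "0 < k" "k < 1" and modulus: "k * sin L \<le> L * cos L"
begin

lemma CAT': "CAT_space \<kappa> TYPE('a)"
  using CAT by (simp add: CAT_space_def)

lemma dist_less: "2 * dist (x :: 'a) y < pi / sqrt \<kappa>"
  using small[of x y] L \<kappa>_pos by (simp add: field_simps)

sublocale geodesic_square_convex k X
proof
  fix x y z m :: 'a and S t
  show "0 < k" by (rule k)
  show "bounded (UNIV :: 'a set)" by (rule bounded_UNIV)
  have "dist x y < pi / sqrt \<kappa>"
    using dist_less[of x y] zero_le_dist[of x y] by linarith
  then show "\<exists>S. segment x y S" using CAT' unfolding CAT_space_def by blast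
  assume "segment x y S" "m \<in> S" "dist x m = t * dist x y" "0 \<le> t" "t \<le> 1"
  then show "(dist m z)\<^sup>2 \<le> (1 - t) * (dist x z)\<^sup>2 + t * (dist y z)\<^sup>2 - k * (t * (1 - t) * (dist x y)\<^sup>2)"
    using k by (intro small_CAT_square_convex[OF \<kappa>_pos CAT' L small _ _ modulus]) auto
qed

text \<open>
  The angle at the projection \<open>q\<close> between the geodesics to \<open>x\<close> and to \<open>p\<close> is at least \<open>\<pi>/2\<close>, so the spherical
  theorem of Pythagoras becomes \<open>cos d(p, x) \<le> cos d(q, p) cos d(q, x) \<le> cos d(q, p)\<close> for scaled distances.
  Strong convexity of squared distances with \<open>k < 1\<close> would only give \<open>k d\<^sup>2(q, p) \<le> d\<^sup>2(x, p)\<close>, so the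
  cosine inequality itself is used, differentiated at the end \<open>q\<close> of the segment from \<open>q\<close> to \<open>p\<close>.
\<close>

lemma metric_proj_contracts:
  fixes x p :: 'a
  assumes K: "closed K" "geodesically_convex K" and p: "p \<in> K"
  shows "dist (metric_proj K x) p \<le> dist x p"
proof (cases "metric_proj K x = p")
  case False
  define q where "q = metric_proj K x"
  have q: "q \<in> K" "\<And>r. r \<in> K \<Longrightarrow> dist x q \<le> dist x r"
    using metric_proj_nearest[OF _ K] p unfolding q_def by auto
  define \<alpha> \<beta> \<gamma> where "\<alpha> = sqrt \<kappa> * dist q p" and "\<beta> = sqrt \<kappa> * dist q x" and "\<gamma> = sqrt \<kappa> * dist p x"
  have s: "0 < sqrt \<kappa>" using \<kappa>_pos by simp
  have \<alpha>: "0 < \<alpha>" using False s by (simp add: \<alpha>_def q_def)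
  have le_L: "\<alpha> \<le> L" "\<beta> \<le> L" "\<gamma> \<le> L" by (auto simp: \<alpha>_def \<beta>_def \<gamma>_def intro: small)
  have ge0: "0 \<le> \<beta>" "0 \<le> \<gamma>" using s by (auto simp: \<beta>_def \<gamma>_def)
  obtain S where S: "segment q p S" using segment_exists by blast
  have SK: "S \<subseteq> K" using S q(1) p K(2) unfolding geodesically_convex_def by blast
  \<comment> \<open>The nonnegativity of \<open>G\<close> combines the cosine inequality with the minimality of \<open>q\<close>; as \<open>G 0 = 0\<close>,
      the derivative at \<open>0\<close> is nonnegative.\<close>
  define G where "G = (\<lambda>t. sin \<alpha> * cos \<beta> - sin ((1 - t) * \<alpha>) * cos \<beta> - sin (t * \<alpha>) * cos \<gamma>)"
  have G_nonneg: "0 \<le> G t" if t: "0 \<le> t" "t \<le> 1" for t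
  proof -
    obtain m where m: "m \<in> S" "dist q m = t * dist q p" "dist m p = (1 - t) * dist q p"
      by (rule segment_point[OF S t])
    have "dist q p + dist p x + dist x q < 2 * (pi / sqrt \<kappa>)"
         "dist p x < pi / sqrt \<kappa>" "dist x q < pi / sqrt \<kappa>"
      using dist_less[of q p] dist_less[of p x] dist_less[of x q]
        zero_le_dist[of q p] zero_le_dist[of p x] zero_le_dist[of x q] by linarith+
    from CAT_cosine_inequality[OF \<kappa>_pos CAT' S m(1) this(2,3,1)]
    have "sin ((1 - t) * \<alpha>) * cos \<beta> + sin (t * \<alpha>) * cos \<gamma> \<le> sin \<alpha> * cos (sqrt \<kappa> * dist m x)"
      unfolding m \<alpha>_def \<beta>_def \<gamma>_def by (simp only: mult.left_commute[of "sqrt \<kappa>"])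
    also have "\<dots> \<le> sin \<alpha> * cos \<beta>"
    proof (intro mult_left_mono)
      have "dist q x \<le> dist m x" using q(2)[of m] m(1) SK by (auto simp: dist_commute)
      then show "cos (sqrt \<kappa> * dist m x) \<le> cos \<beta>"
        using s ge0 small[of m x] L unfolding \<beta>_def by (intro cos_monotone_0_pi_le) auto
      show "0 \<le> sin \<alpha>" using \<alpha> le_L L by (intro sin_ge_zero) auto
    qed
    finally show ?thesis by (simp add: G_def)
  qed
  have "(G has_real_derivative \<alpha> * (cos \<alpha> * cos \<beta> - cos \<gamma>)) (at 0)"
    unfolding G_def by (auto intro!: derivative_eq_intros simp: algebra_simps)
  have "0 \<le> \<alpha> * (cos \<alpha> * cos \<beta> - cos \<gamma>)"
  proof (rule ccontr)
    assume "\<not> ?thesis"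
    then obtain d where d: "0 < d" "\<And>h. 0 < h \<Longrightarrow> h < d \<Longrightarrow> G (0 + h) < G 0"
      using DERIV_neg_dec_right[OF \<open>(G has_real_derivative _) _\<close>] by auto
    have "G (min (d / 2) 1) < 0" using d(2)[of "min (d / 2) 1"] d(1) by (simp add: G_def)
    moreover have "0 \<le> G (min (d / 2) 1)" using d(1) by (intro G_nonneg) auto
    ultimately show False by simp
  qed
  then have "cos \<gamma> \<le> cos \<alpha> * cos \<beta>" using \<alpha> by (simp add: zero_le_mult_iff)
  also have "\<dots> \<le> cos \<alpha>"
    using \<alpha> le_L L by (intro mult_left_le cos_ge_zero) auto
  finally have "\<alpha> \<le> \<gamma>" using cos_mono_le_eq[of \<gamma> \<alpha>] \<alpha> ge0 le_L L by simp
  then show ?thesis using s by (simp add: \<alpha>_def \<gamma>_def q_def dist_commute)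
qed simp

text \<open>
  Projecting onto \<open>K\<close> does not increase the asymptotic radius, and the center is unique.
\<close>

lemma asymptotic_center_in_closed_convex:
  fixes z :: 'a
  assumes K: "closed K" "geodesically_convex K" and s: "\<And>n. s n \<in> K"
    and z: "z \<in> asymptotic_center s"
  shows "z \<in> K"
proof -
  have "arad s (metric_proj K z) \<le> arad s z"
    using metric_proj_contracts[OF K s] by (intro arad_mono) simp
  then have "metric_proj K z \<in> asymptotic_center s"
    using z by (auto simp: asymptotic_center_iff intro: order_trans)
  then have "metric_proj K z = z" using z asymptotic_center_singleton[of s] by auto
  then show ?thesis using metric_proj_nearest(1)[OF _ K, of z] s by auto
qed

lemma Ishikawa_step:
  fixes x v p :: 'a
  assumes K: "closed K" "geodesically_convex K" and p: "p \<in> K" and b: "b \<in> {0..1}"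
    and v: "(dist v p)\<^sup>2 \<le> (dist x p)\<^sup>2 + c * (dist x v)\<^sup>2"
  shows "(dist (metric_proj K (geodesic_comb b x v)) p)\<^sup>2
    \<le> (dist x p)\<^sup>2 - b * ((1 - b) * k - c) * (dist x v)\<^sup>2"
proof -
  have "(dist (metric_proj K (geodesic_comb b x v)) p)\<^sup>2 \<le> (dist (geodesic_comb b x v) p)\<^sup>2"
    by (intro power_mono metric_proj_contracts K p) simp
  also have "\<dots> \<le> (1 - b) * (dist x p)\<^sup>2 + b * (dist v p)\<^sup>2 - k * (b * (1 - b) * (dist x v)\<^sup>2)"
    using b by (intro geodesic_comb_square_convex) auto
  also have "\<dots> \<le> (1 - b) * (dist x p)\<^sup>2 + b * ((dist x p)\<^sup>2 + c * (dist x v)\<^sup>2) - k * (b * (1 - b) * (dist x v)\<^sup>2)"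
    using b v by (intro diff_right_mono add_left_mono mult_left_mono) auto
  also have "\<dots> = (dist x p)\<^sup>2 - b * ((1 - b) * k - c) * (dist x v)\<^sup>2"
    by (simp add: algebra_simps)
  finally show ?thesis .
qed

end


section \<open>Generalized hybrid mappings\<close>

lemma infdist_le_hausdorff_dist:
  fixes A B :: "'a::metric_space set"
  assumes bd: "bounded (UNIV :: 'a set)" and ne: "A \<noteq> {}" "B \<noteq> {}"
  shows "a \<in> A \<Longrightarrow> infdist a B \<le> hausdorff_dist A B" "b \<in> B \<Longrightarrow> infdist b A \<le> hausdorff_dist A B"
proof -
  obtain M where M: "\<forall>x y :: 'a. dist x y \<le> M"
    using bd unfolding bounded_two_points by auto
  have bdd: "bdd_above ((\<lambda>x. infdist x C) ` D)" if "C \<noteq> {}" for C D :: "'a set"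
  proof -
    obtain c where "c \<in> C" using \<open>C \<noteq> {}\<close> by auto
    then show ?thesis using M by (intro bdd_aboveI[of _ M]) (auto intro: infdist_le2)
  qed
  show "infdist a B \<le> hausdorff_dist A B" if "a \<in> A"
    unfolding hausdorff_dist_def using cSUP_upper[OF that bdd[OF ne(2)]] by (simp add: le_max_iff_disj)
  show "infdist b A \<le> hausdorff_dist A B" if "b \<in> B"
    unfolding hausdorff_dist_def using cSUP_upper[OF that bdd[OF ne(1)]] by (simp add: le_max_iff_disj)
qed

lemma hausdorff_dist_le:
  fixes A B :: "'a::metric_space set"
  assumes "A \<noteq> {}" "B \<noteq> {}" and M: "\<And>x y :: 'a. dist x y \<le> M"
  shows "hausdorff_dist A B \<le> M"
proof -
  have *: "infdist x C \<le> M" if "C \<noteq> {}" for x and C :: "'a set"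
    using that M by (auto intro: infdist_le2)
  show ?thesis
    unfolding hausdorff_dist_def by (intro max.boundedI cSUP_least * assms(1,2))
qed

lemma generalized_hybrid_II_ineq:
  assumes "generalized_hybrid_II K T a\<^sub>1 a\<^sub>2 a\<^sub>3 k\<^sub>1 k\<^sub>2" "x \<in> K" "y \<in> K"
  shows "(hausdorff_dist (T x) (T y))\<^sup>2 \<le>
          a\<^sub>1 x * (dist x y)\<^sup>2 + a\<^sub>2 x * (infdist y (T x))\<^sup>2 + a\<^sub>3 x * (infdist x (T y))\<^sup>2
          + k\<^sub>1 x * (infdist x (T x))\<^sup>2 + k\<^sub>2 x * (infdist y (T y))\<^sup>2"
  using assms unfolding generalized_hybrid_II_def by blast

lemma generalized_hybrid_II_coeffs:
  assumes "generalized_hybrid_II K T a\<^sub>1 a\<^sub>2 a\<^sub>3 k\<^sub>1 k\<^sub>2" "x \<in> K"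
  shows "0 \<le> a\<^sub>1 x" "0 \<le> a\<^sub>2 x" "0 \<le> a\<^sub>3 x" "0 \<le> k\<^sub>1 x" "0 \<le> k\<^sub>2 x" "k\<^sub>2 x \<le> 1"
    "a\<^sub>1 x + a\<^sub>2 x + a\<^sub>3 x < 1"
  using assms unfolding generalized_hybrid_II_def Pi_iff by auto

text \<open>
  Both \<open>d(v, p)\<close> and \<open>d(p, Tx)\<close> are at most the Hausdorff distance \<open>H\<close> of \<open>Tp = {p}\<close> and \<open>Tx\<close>. The
  term with \<open>a\<^sub>3\<close> in the hybrid inequality at \<open>(p, x)\<close> is therefore absorbed into \<open>H\<^sup>2\<close>, at the price
  of the factor \<open>1 / (1 - a\<^sub>3)\<close>.
\<close>

lemma generalized_hybrid_II_fixed_point: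
  fixes T :: "'a::metric_space \<Rightarrow> 'a set"
  assumes bd: "bounded (UNIV :: 'a set)" and hyb: "generalized_hybrid_II K T a\<^sub>1 a\<^sub>2 a\<^sub>3 k\<^sub>1 k\<^sub>2"
    and p: "p \<in> K" "T p = {p}" and x: "x \<in> K" "v \<in> T x"
  shows "(dist v p)\<^sup>2 \<le> (dist x p)\<^sup>2 + k\<^sub>2 p / (1 - a\<^sub>3 p) * (dist x v)\<^sup>2"
proof -
  note c = generalized_hybrid_II_coeffs[OF hyb p(1)]
  define H where "H = hausdorff_dist (T p) (T x)"
  have ne: "T p \<noteq> {}" "T x \<noteq> {}" using p x by auto
  have vH: "dist v p \<le> H"
    using infdist_le_hausdorff_dist(2)[OF bd ne x(2)] p(2) by (simp add: H_def)
  have "infdist p (T x) \<le> H"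
    using infdist_le_hausdorff_dist(1)[OF bd ne, of p] p(2) by (simp add: H_def)
  then have "(infdist p (T x))\<^sup>2 \<le> H\<^sup>2" by (intro power_mono infdist_nonneg)
  then have "a\<^sub>3 p * (infdist p (T x))\<^sup>2 \<le> a\<^sub>3 p * H\<^sup>2" using c by (intro mult_left_mono)
  moreover have "k\<^sub>2 p * (infdist x (T x))\<^sup>2 \<le> k\<^sub>2 p * (dist x v)\<^sup>2"
    using c x(2) by (intro mult_left_mono power_mono infdist_le infdist_nonneg)
  moreover have "H\<^sup>2 \<le> a\<^sub>1 p * (dist x p)\<^sup>2 + a\<^sub>2 p * (dist x p)\<^sup>2 + a\<^sub>3 p * (infdist p (T x))\<^sup>2
      + k\<^sub>2 p * (infdist x (T x))\<^sup>2"
    using generalized_hybrid_II_ineq[OF hyb p(1) x(1)] by (simp add: H_def p(2) dist_commute)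
  moreover have "a\<^sub>1 p * (dist x p)\<^sup>2 + a\<^sub>2 p * (dist x p)\<^sup>2 \<le> (1 - a\<^sub>3 p) * (dist x p)\<^sup>2"
    using c(7) by (simp add: distrib_right[symmetric] mult_right_mono)
  ultimately have "(1 - a\<^sub>3 p) * H\<^sup>2 \<le> (1 - a\<^sub>3 p) * (dist x p)\<^sup>2 + k\<^sub>2 p * (dist x v)\<^sup>2"
    by (simp add: left_diff_distrib)
  moreover have pos: "0 < 1 - a\<^sub>3 p" using c by linarith
  ultimately have "H\<^sup>2 \<le> (dist x p)\<^sup>2 + k\<^sub>2 p / (1 - a\<^sub>3 p) * (dist x v)\<^sup>2"
    by (simp add: field_simps)
  moreover have "(dist v p)\<^sup>2 \<le> H\<^sup>2" using vH by (intro power_mono) auto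
  ultimately show ?thesis by simp
qed

text \<open>
  The hybrid inequality at \<open>(z, x)\<close>, where every occurrence of \<open>Tx\<close> is replaced by \<open>x\<close>
  at a cost proportional to \<open>d(x, Tx)\<close>; the term with \<open>a\<^sub>2\<close> is absorbed into the left-hand side.
\<close>

lemma generalized_hybrid_II_demiclosed_bound:
  fixes T :: "'a::metric_space \<Rightarrow> 'a set"
  assumes M: "\<And>x y :: 'a. dist x y \<le> M" and hyb: "generalized_hybrid_II K T a\<^sub>1 a\<^sub>2 a\<^sub>3 k\<^sub>1 k\<^sub>2"
    and T: "\<And>p. p \<in> K \<Longrightarrow> T p \<noteq> {} \<and> compact (T p)"
    and z: "z \<in> K" and x: "x \<in> K"
  shows "(infdist x (T z))\<^sup>2 \<le> (dist z x)\<^sup>2 + k\<^sub>1 z / (1 - a\<^sub>2 z) * (infdist z (T z))\<^sup>2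
      + (3 * M + 7 * M / (1 - a\<^sub>2 z)) * infdist x (T x)"
proof -
  note c = generalized_hybrid_II_coeffs[OF hyb z]
  note ne = T[OF z, THEN conjunct1] T[OF x, THEN conjunct1]
  have bd: "bounded (UNIV :: 'a set)" unfolding bounded_two_points using M by auto
  define H where "H = hausdorff_dist (T z) (T x)"
  define e where "e = infdist x (T x)"
  define d where "d = dist z x"
  define h where "h = infdist x (T z)"
  define D where "D = infdist z (T z)"
  have M0: "0 \<le> M" using M[of x x] by simp
  have e: "0 \<le> e" "e \<le> M"
    using ne M by (auto simp: e_def infdist_nonneg intro: infdist_le2)
  have d: "0 \<le> d" "d \<le> M" using M by (auto simp: d_def)
  have h0: "0 \<le> h" by (simp add: h_def infdist_nonneg)
  obtain v where v: "v \<in> T x" "e = dist x v"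
    using infdist_attained T[OF x] unfolding e_def by metis
  have vH: "infdist v (T z) \<le> H"
    unfolding H_def by (rule infdist_le_hausdorff_dist(2)[OF bd ne v(1)])
  then have H0: "0 \<le> H" using infdist_nonneg order_trans by blast
  have HM: "H \<le> M" unfolding H_def by (rule hausdorff_dist_le[OF ne M])
  have "h \<le> H + e"
    unfolding h_def using infdist_triangle[of x "T z" v] v(2) vH by simp
  then have "h\<^sup>2 \<le> (H + e)\<^sup>2" using h0 by (intro power_mono)
  also have "\<dots> = H\<^sup>2 + (2 * H + e) * e" by (simp add: power2_eq_square algebra_simps)
  also have "\<dots> \<le> H\<^sup>2 + 3 * M * e"
    using HM e by (intro add_left_mono mult_right_mono) auto
  finally have 1: "h\<^sup>2 \<le> H\<^sup>2 + 3 * M * e" .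
  have "infdist z (T x) \<le> d + e"
    unfolding d_def using infdist_triangle[of z "T x" x] by (simp add: e_def)
  then have "(infdist z (T x))\<^sup>2 \<le> (d + e)\<^sup>2" by (intro power_mono infdist_nonneg)
  also have "\<dots> = d\<^sup>2 + (2 * d + e) * e" by (simp add: power2_eq_square algebra_simps)
  also have "\<dots> \<le> d\<^sup>2 + 3 * M * e"
    using d e by (intro add_left_mono mult_right_mono) auto
  finally have "a\<^sub>3 z * (infdist z (T x))\<^sup>2 \<le> a\<^sub>3 z * (d\<^sup>2 + 3 * M * e)"
    using c by (intro mult_left_mono)
  also have "\<dots> \<le> a\<^sub>3 z * d\<^sup>2 + 3 * M * e"
    using c M0 e mult_right_mono[of "a\<^sub>3 z" 1 "3 * M * e"] by (simp add: distrib_left)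
  finally have 2: "a\<^sub>3 z * (infdist z (T x))\<^sup>2 \<le> a\<^sub>3 z * d\<^sup>2 + 3 * M * e" .
  have "e\<^sup>2 \<le> M * e" using e by (simp add: power2_eq_square mult_right_mono)
  moreover have "k\<^sub>2 z * e\<^sup>2 \<le> 1 * e\<^sup>2" using c by (intro mult_right_mono) auto
  ultimately have 3: "k\<^sub>2 z * e\<^sup>2 \<le> M * e" by simp
  have 4: "H\<^sup>2 \<le> a\<^sub>1 z * d\<^sup>2 + a\<^sub>2 z * h\<^sup>2 + a\<^sub>3 z * (infdist z (T x))\<^sup>2 + k\<^sub>1 z * D\<^sup>2 + k\<^sub>2 z * e\<^sup>2"
    using generalized_hybrid_II_ineq[OF hyb z x] by (simp add: H_def d_def h_def D_def e_def)
  have 5: "a\<^sub>1 z * d\<^sup>2 + a\<^sub>3 z * d\<^sup>2 \<le> (1 - a\<^sub>2 z) * d\<^sup>2"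
    using c(7) by (simp add: distrib_right[symmetric] mult_right_mono)
  \<comment> \<open>The three errors \<open>3 M e\<close>, \<open>3 M e\<close> and \<open>M e\<close> from the facts 1, 2 and 3 add up to \<open>7 M e\<close>.\<close>
  have "(1 - a\<^sub>2 z) * h\<^sup>2 \<le> (1 - a\<^sub>2 z) * d\<^sup>2 + k\<^sub>1 z * D\<^sup>2 + 7 * M * e"
    using 1 2 3 4 5 by (simp add: left_diff_distrib)
  moreover have pos: "0 < 1 - a\<^sub>2 z" using c by linarith
  ultimately have "h\<^sup>2 \<le> ((1 - a\<^sub>2 z) * d\<^sup>2 + k\<^sub>1 z * D\<^sup>2 + 7 * M * e) / (1 - a\<^sub>2 z)"
    by (simp add: pos_le_divide_eq mult.commute)
  also have "\<dots> = d\<^sup>2 + k\<^sub>1 z / (1 - a\<^sub>2 z) * D\<^sup>2 + 7 * M / (1 - a\<^sub>2 z) * e"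
    using pos by (simp add: add_divide_distrib)
  finally have "h\<^sup>2 \<le> d\<^sup>2 + k\<^sub>1 z / (1 - a\<^sub>2 z) * D\<^sup>2 + 7 * M / (1 - a\<^sub>2 z) * e" .
  moreover have "0 \<le> 3 * M * e" using M0 e(1) by simp
  ultimately show ?thesis
    unfolding h_def d_def D_def e_def distrib_right by linarith
qed


section \<open>Convergence of the iteration\<close>

lemma liminf_pos_bound:
  fixes f :: "nat \<Rightarrow> real"
  assumes "liminf (\<lambda>n. ereal (f n)) > 0"
  obtains \<delta> where "0 < \<delta>" "\<forall>\<^sub>F n in sequentially. \<delta> < f n"
proof -
  obtain \<delta> where "0 < ereal \<delta>" "ereal \<delta> < liminf (\<lambda>n. ereal (f n))"
    using ereal_dense2[OF assms] by blast
  then show ?thesis using that less_LiminfD[of "ereal \<delta>"] by fastforce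
qed

lemma Fejer_residual:
  fixes d e :: "nat \<Rightarrow> real"
  assumes nonneg: "\<And>n. 0 \<le> d n" and "0 < \<delta>"
    and step: "\<forall>\<^sub>F n in sequentially. (d (Suc n))\<^sup>2 \<le> (d n)\<^sup>2 - \<delta> * (e n)\<^sup>2"
  shows "convergent d" "e \<longlonglongrightarrow> 0"
proof -
  obtain N where N: "\<And>n. N \<le> n \<Longrightarrow> (d (Suc n))\<^sup>2 \<le> (d n)\<^sup>2 - \<delta> * (e n)\<^sup>2"
    using step unfolding eventually_sequentially by blast
  have "d (Suc n) \<le> d n" if "N \<le> n" for n
  proof (rule power2_le_imp_le[OF _ nonneg])
    have "0 \<le> \<delta> * (e n)\<^sup>2" using \<open>0 < \<delta>\<close> by simp
    then show "(d (Suc n))\<^sup>2 \<le> (d n)\<^sup>2" using N[OF that] by linarith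
  qed
  then have "decseq (\<lambda>n. d (n + N))" by (simp add: decseq_Suc_iff)
  then have "convergent (\<lambda>n. d (n + N))"
    using decseq_convergent[of "\<lambda>n. d (n + N)" 0] nonneg convergent_def by blast
  then show conv: "convergent d" by (simp only: convergent_ignore_initial_segment)
  then obtain l where l: "d \<longlonglongrightarrow> l" unfolding convergent_def by blast
  have "(\<lambda>n. ((d n)\<^sup>2 - (d (Suc n))\<^sup>2) / \<delta>) \<longlonglongrightarrow> (l\<^sup>2 - l\<^sup>2) / \<delta>"
    using \<open>0 < \<delta>\<close> by (intro tendsto_intros l LIMSEQ_Suc[OF l]) auto
  moreover have "\<forall>\<^sub>F n in sequentially. (e n)\<^sup>2 \<le> ((d n)\<^sup>2 - (d (Suc n))\<^sup>2) / \<delta>"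
    using step \<open>0 < \<delta>\<close> by (auto elim!: eventually_mono simp: field_simps)
  ultimately have "(\<lambda>n. (e n)\<^sup>2) \<longlonglongrightarrow> 0"
    by (intro tendsto_sandwich[of "\<lambda>_. 0" "\<lambda>n. (e n)\<^sup>2" sequentially]) auto
  from tendsto_real_sqrt[OF this] show "e \<longlonglongrightarrow> 0" by (simp add: tendsto_rabs_zero_iff)
qed

theorem theorem4p19:
  fixes \<kappa> \<epsilon> R :: real
    and K :: "'a::complete_space set"
    and T :: "'a \<Rightarrow> 'a set"
    and a\<^sub>1 a\<^sub>2 a\<^sub>3 k\<^sub>1 k\<^sub>2 :: "'a \<Rightarrow> real"
    and \<alpha> \<beta> :: "nat \<Rightarrow> real"
    and x y u v :: "nat \<Rightarrow> 'a"
  assumes "\<kappa> > 0"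
    and "CAT_space \<kappa> TYPE('a)"
    and "0 < \<epsilon>" "\<epsilon> < pi / 2"
    and "bounded (UNIV :: 'a set)"
    and "diameter (UNIV :: 'a set) \<le> (pi - \<epsilon>) / (2 * sqrt \<kappa>)"
    and "R = (pi - 2 * \<epsilon>) * tan \<epsilon>"
    and "K \<noteq> {}" "closed K" "geodesically_convex K"
    and "\<forall>p\<in>K. T p \<in> KC"
    and "generalized_hybrid_II K T a\<^sub>1 a\<^sub>2 a\<^sub>3 k\<^sub>1 k\<^sub>2"
    and "\<forall>p\<in>K. 2 * k\<^sub>1 p / (1 - a\<^sub>2 p) < R / 2"
    and "fixed_points K T \<noteq> {}"
    and "\<forall>p\<in>fixed_points K T. T p = {p}"
    and "\<forall>n. \<alpha> n \<in> {0..1}" "\<forall>n. \<beta> n \<in> {0..1}"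
    and "\<forall>n. x n \<in> K"
    and "\<forall>n. v n \<in> T (x n)"
    and "\<forall>n. y n = metric_proj K (geodesic_comb (\<beta> n) (x n) (v n))"
    and "\<forall>n. u n \<in> T (y n)"
    and "\<forall>n. x (Suc n) = metric_proj K (geodesic_comb (\<alpha> n) (y n) (u n))"
    and "\<forall>p\<in>K. liminf (\<lambda>n. ereal (\<alpha> n * ((1 - \<alpha> n) * (R / 2) - 2 * k\<^sub>2 p / (1 - a\<^sub>3 p)))) > 0"
    and "\<forall>p\<in>K. liminf (\<lambda>n. ereal (\<beta> n * ((1 - \<beta> n) * (R / 2) - 2 * k\<^sub>2 p / (1 - a\<^sub>3 p)))) > 0"
  shows "\<exists>z. Delta_convergent_to x z \<and> z \<in> fixed_points K T"
proof -
  note K = assms(9,10) and hyb = assms(12)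
  note bd = assms(5)
  define L where "L = (pi - \<epsilon>) / 2"
  define k where "k = R / 4"
  have R: "R = 4 * k" by (simp add: k_def)
  interpret small_CAT_space \<kappa> L k "TYPE('a)"
  proof
    show "0 < \<kappa>" "CAT_space \<kappa> TYPE('a)" "bounded (UNIV :: 'a set)" by fact+
    show "0 < L" "L < pi / 2" using assms(3,4) by (auto simp: L_def)
    have "0 < tan \<epsilon>" using assms(3,4) by (intro tan_gt_zero) auto
    then show "0 < k" using assms(4) by (simp add: k_def assms(7))
    show "k < 1" using modulus_quarter_le_half[OF assms(3,4)] unfolding k_def assms(7) by linarith
    show "k * sin L \<le> L * cos L"
      unfolding k_def assms(7) L_def by (rule modulus_quarter_le[OF assms(3,4)])
    show "sqrt \<kappa> * dist p q \<le> L" for p q :: 'a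
    proof -
      have "dist p q \<le> (pi - \<epsilon>) / (2 * sqrt \<kappa>)"
        using diameter_bounded_bound[OF bd, of p q] assms(6) by simp
      then show ?thesis using assms(1) by (simp add: L_def field_simps)
    qed
  qed
  obtain M where M: "\<And>p q :: 'a. dist p q \<le> M" using dist_bound by blast
  have T: "T p \<noteq> {} \<and> compact (T p)" if "p \<in> K" for p
    using assms(11) that by (auto simp: KC_def)
  have xK: "x n \<in> K" for n using assms(18) by blast
  have yK: "y n \<in> K" for n
    unfolding assms(20)[rule_format] by (rule metric_proj_nearest(1)[OF assms(8) K])

  have Fejer: "convergent (\<lambda>n. dist (x n) p)" "(\<lambda>n. dist (x n) (v n)) \<longlonglongrightarrow> 0"
    if "p \<in> fixed_points K T" for p
  proof -
    have p: "p \<in> K" "T p = {p}" using that assms(15) unfolding fixed_points_def by blast+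
    define c where "c = k\<^sub>2 p / (1 - a\<^sub>3 p)"
    define f where "f = (\<lambda>b. b * ((1 - b) * k - c))"
    have f: "t * ((1 - t) * (R / 2) - 2 * k\<^sub>2 p / (1 - a\<^sub>3 p)) = 2 * f t" for t
      by (simp add: f_def R c_def algebra_simps)
    have y_step: "(dist (y n) p)\<^sup>2 \<le> (dist (x n) p)\<^sup>2 - f (\<beta> n) * (dist (x n) (v n))\<^sup>2" for n
      unfolding f_def c_def assms(20)[rule_format]
      using assms(17,19) by (intro Ishikawa_step K p generalized_hybrid_II_fixed_point[OF bd hyb p xK]) auto
    have x_step: "(dist (x (Suc n)) p)\<^sup>2 \<le> (dist (y n) p)\<^sup>2 - f (\<alpha> n) * (dist (y n) (u n))\<^sup>2" for n
      unfolding f_def c_def assms(22)[rule_format]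
      using assms(16,21) by (intro Ishikawa_step K p generalized_hybrid_II_fixed_point[OF bd hyb p yK]) auto
    obtain \<delta> where \<delta>: "0 < \<delta>" "\<forall>\<^sub>F n in sequentially. \<delta> < 2 * f (\<beta> n)"
      using liminf_pos_bound[OF assms(24)[rule_format, OF p(1), unfolded f]] by blast
    obtain \<delta>' where \<delta>': "0 < \<delta>'" "\<forall>\<^sub>F n in sequentially. \<delta>' < 2 * f (\<alpha> n)"
      using liminf_pos_bound[OF assms(23)[rule_format, OF p(1), unfolded f]] by blast
    \<comment> \<open>The step from \<open>y n\<close> to \<open>x (Suc n)\<close> only has to be nonincreasing; the decrease comes from the first step.\<close>
    have "\<forall>\<^sub>F n in sequentially. (dist (x (Suc n)) p)\<^sup>2 \<le> (dist (x n) p)\<^sup>2 - \<delta> / 2 * (dist (x n) (v n))\<^sup>2"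
      using \<delta>(2) \<delta>'(2)
    proof eventually_elim
      case (elim n)
      have "0 \<le> f (\<alpha> n) * (dist (y n) (u n))\<^sup>2" using elim(2) \<delta>'(1) by simp
      moreover have "\<delta> / 2 * (dist (x n) (v n))\<^sup>2 \<le> f (\<beta> n) * (dist (x n) (v n))\<^sup>2"
        using elim(1) by (intro mult_right_mono) auto
      ultimately show ?case using x_step[of n] y_step[of n] by linarith
    qed
    then show "convergent (\<lambda>n. dist (x n) p)" "(\<lambda>n. dist (x n) (v n)) \<longlonglongrightarrow> 0"
      using \<delta>(1) Fejer_residual[of "\<lambda>n. dist (x n) p" "\<delta> / 2"] by simp_all
  qed

  have residual: "(\<lambda>n. infdist (x n) (T (x n))) \<longlonglongrightarrow> 0"
  proof (rule tendsto_sandwich[of "\<lambda>_. 0"])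
    show "(\<lambda>n. dist (x n) (v n)) \<longlonglongrightarrow> 0" using Fejer(2) assms(14) by blast
  qed (use assms(19) in \<open>auto intro!: always_eventually infdist_nonneg infdist_le\<close>)

  show ?thesis
  proof (rule Delta_convergent_if_Fejer)
    show "convergent (\<lambda>n. dist p (x n))" if "p \<in> fixed_points K T" for p
      using Fejer(1)[OF that] by (simp add: dist_commute)
    fix \<psi> z assume \<psi>: "strict_mono \<psi>" and reg: "regular (x \<circ> \<psi>)"
      and z: "z \<in> asymptotic_center (x \<circ> \<psi>)"
    have zK: "z \<in> K" using xK by (intro asymptotic_center_in_closed_convex[OF K _ z]) simp
    define q where "q = k\<^sub>1 z / (1 - a\<^sub>2 z)"
    note c = generalized_hybrid_II_coeffs[OF hyb zK]
    have q: "0 \<le> q" "q < k"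
      using c assms(13) zK by (auto simp: q_def R)
    have "z \<in> T z"
    proof (rule asymptotic_center_in_compact[OF reg z _ _ q])
      show "compact (T z)" "T z \<noteq> {}" using T[OF zK] by auto
      let ?C = "3 * M + 7 * M / (1 - a\<^sub>2 z)"
      show "(infdist ((x \<circ> \<psi>) n) (T z))\<^sup>2 \<le> (dist z ((x \<circ> \<psi>) n))\<^sup>2 + q * (infdist z (T z))\<^sup>2
          + ?C * infdist (x (\<psi> n)) (T (x (\<psi> n)))" for n
        unfolding q_def comp_apply
        by (rule generalized_hybrid_II_demiclosed_bound[OF M hyb T zK xK])
      have "(\<lambda>n. infdist (x (\<psi> n)) (T (x (\<psi> n)))) \<longlonglongrightarrow> 0"
        using LIMSEQ_subseq_LIMSEQ[OF residual \<psi>] by (simp add: comp_def)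
      then show "(\<lambda>n. ?C * infdist (x (\<psi> n)) (T (x (\<psi> n)))) \<longlonglongrightarrow> 0"
        by (rule tendsto_mult_right_zero)
    qed
    with zK show "z \<in> fixed_points K T" by (simp add: fixed_points_def)
  qed
qed

end
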